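(* Let $k\in\mathbb{Z}$, $k\ne0$, and consider the integration problem $I_{\varrho_k}(f)=\int_0^1 f(x)e^{-2\pi i kx}\,dx$ for functions $f$ from the space $H^1([0,1])$. For $n\in\mathbb{N}=\{1,2,\dots\}$ let $A^k_{n+1}$ be the spline algorithm with the equidistant nodes $x_j=j/n$, $j=0,1,\dots,n$. Then: (i) For every $n\in\mathbb{N}$, the worst case error of $A^k_{n+1}$ is $$e(A^k_{n+1},I_{\varrho_k},H^1)=\frac{1}{2\pi|k|}\left(1-\frac{n^2}{k^2\pi^2}\sin^2\left(\frac{k\pi}{n}\right)\right)^{1/2}.$$ (ii) For every $n\in\mathbb{N}$, $$e(A^k_{n+1},I_{\varrho_k},H^1)<e(0,I_{\varrho_k},H^1_0)=\frac{1}{2\pi|k|}\qquad\text{if } k\not\equiv 0 \bmod n.$$ (iii) For fixed $n\in\mathbb{N}$, $$\lim_{|k|\to\infty}e(A^k_{n+1},I_{\varrho_k},H^1)\cdot|k|=\frac{1}{2\pi}.$$ (iv) For all $k\in\mathbb{Z}\setminus\{0\}$ and $n\in\mathbb{N}$, $$e(A^k_{n+1},I_{\varrho_k},H^1)\le\frac{1}{2\sqrt3}\,\frac1n.$$ (v) For fixed $k\in\mathbb{Z}\setminus\{0\}$, $$\lim_{n\to\infty}e(A^k_{n+1},I_{\varrho_k},H^1)\cdot n=\frac{1}{2\sqrt3}.$$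
   Context: $H^1([0,1])$ is the space of all absolutely continuous $f:[0,1]\to\mathbb{C}$ with $f'\in L_2([0,1])$, equipped with the semi-norm $\|f\|:=\|f'\|_{L_2}$; $H^1_0([0,1])$ is the subspace of those $f$ with $f(0)=f(1)=0$, on which $\|\cdot\|$ is a norm. The algorithm $A^k_{n+1}$ is defined by $A^k_{n+1}(f)=I_{\varrho_k}(\sigma)=\int_0^1\sigma(x)e^{-2\pi i kx}\,dx$, where $\sigma$ is the continuous piecewise linear function on $[0,1]$ with $\sigma(x_j)=f(x_j)$ for $x_j=j/n$, $j=0,\dots,n$, and linear on each $[x_j,x_{j+1}]$. Its worst case error is $e(A^k_{n+1},I_{\varrho_k},H^1)=\sup\{|I_{\varrho_k}(f)-A^k_{n+1}(f)|:f\in H^1([0,1]),\ \|f\|\le1\}$. The initial error on $H^1_0$ is $e(0,I_{\varrho_k},H^1_0)=\sup\{|I_{\varrho_k}(f)|:f\in H^1_0([0,1]),\ \|f\|\le1\}$. *)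

theory Defs
  imports "HOL-Analysis.Analysis"
begin

(* The usual epsilon-delta notion: finite families of non-overlapping compact
   intervals are represented as divisions of their union, so an interval u of
   the family is [Inf u, Sup u]. *)
definition absolutely_continuous_on ::
    "real set \<Rightarrow> (real \<Rightarrow> 'a::real_normed_vector) \<Rightarrow> bool" where
  "absolutely_continuous_on S f \<longleftrightarrow>
     (\<forall>\<epsilon>>0. \<exists>\<delta>>0. \<forall>d t. d division_of t \<and> t \<subseteq> S \<and> (\<Sum>u\<in>d. Sup u - Inf u) < \<delta> \<longrightarrow>
        (\<Sum>u\<in>d. norm (f (Sup u) - f (Inf u))) < \<epsilon>)"

(* Functions on [0,1] are total functions on the reals whose values outside [0,1]
   are never used; hence derivatives are taken within {0..1}. Wherever the
   derivative does not exist its value is arbitrary. *)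
definition deriv01 :: "(real \<Rightarrow> complex) \<Rightarrow> real \<Rightarrow> complex" where
  "deriv01 f x = vector_derivative f (at x within {0..1})"

(* The last three conjuncts say that f' is defined almost everywhere and is an
   element of L2. Almost-everywhere differentiability is already implied by
   absolute continuity (Lebesgue), so it does not restrict the space. *)
definition H1 :: "(real \<Rightarrow> complex) set" where
  "H1 = {f. absolutely_continuous_on {0..1} f \<and>
            (AE x in lebesgue_on {0..1}. f differentiable (at x within {0..1})) \<and>
            deriv01 f \<in> borel_measurable (lebesgue_on {0..1}) \<and>
            integrable (lebesgue_on {0..1}) (\<lambda>x. (norm (deriv01 f x))\<^sup>2)}"

definition H1_0 :: "(real \<Rightarrow> complex) set" where
  "H1_0 = {f \<in> H1. f 0 = 0 \<and> f 1 = 0}"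

definition H1_seminorm :: "(real \<Rightarrow> complex) \<Rightarrow> real" where
  "H1_seminorm f = sqrt (LINT x|lebesgue_on {0..1}. (norm (deriv01 f x))\<^sup>2)"

definition fourier_integral :: "int \<Rightarrow> (real \<Rightarrow> complex) \<Rightarrow> complex" where
  "fourier_integral k f =
     (LINT x|lebesgue_on {0..1}. f x * exp (- 2 * of_real pi * \<i> * of_int k * of_real x))"

(* For x in [j/n, (j+1)/n) the index j is the floor of n * x. *)
definition linear_spline :: "nat \<Rightarrow> (real \<Rightarrow> complex) \<Rightarrow> real \<Rightarrow> complex" where
  "linear_spline n f x =
     (let j = of_int \<lfloor>real n * x\<rfloor>
      in f (j / real n) + of_real (real n * x - j) * (f ((j + 1) / real n) - f (j / real n)))"

(* Includes the right end point of each piece, hence continuity and, as x = j/n or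
   x = (j+1)/n, interpolation at all nodes. *)
lemma linear_spline_on_piece:
  assumes "n \<ge> 1" "x \<in> {real j / real n..(real j + 1) / real n}"
  shows "linear_spline n f x =
           f (real j / real n) +
           of_real (real n * x - real j) * (f ((real j + 1) / real n) - f (real j / real n))"
proof (cases "real n * x = real j + 1")
  case True
  then have "\<lfloor>real n * x\<rfloor> = int j + 1" by linarith
  with True show ?thesis by (simp add: linear_spline_def Let_def algebra_simps)
next
  case False
  with assms have "real j \<le> real n * x" "real n * x < real j + 1"
    by (auto simp: field_simps)
  then have "\<lfloor>real n * x\<rfloor> = int j" by linarith
  then show ?thesis by (simp add: linear_spline_def Let_def)
qed

(* The algorithm with the n + 1 nodes j/n, j = 0, ..., n. *)
definition spline_algorithm :: "int \<Rightarrow> nat \<Rightarrow> (real \<Rightarrow> complex) \<Rightarrow> complex" where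
  "spline_algorithm k n f = fourier_integral k (linear_spline n f)"

(* Extended reals, so that the supremum is meaningful without presupposing boundedness. *)
definition worst_case_error ::
    "((real \<Rightarrow> complex) \<Rightarrow> complex) \<Rightarrow> ((real \<Rightarrow> complex) \<Rightarrow> complex) \<Rightarrow>
     (real \<Rightarrow> complex) set \<Rightarrow> ereal" where
  "worst_case_error A I F = (SUP f\<in>{f \<in> F. H1_seminorm f \<le> 1}. ereal (norm (I f - A f)))"

end

theory Submission
  imports Defs "HOL-Real_Asymp.Real_Asymp"
begin

text \<open>
  Let \<open>E\<close> be an antiderivative of \<open>exp (- 2 * pi * \<i> * k * x)\<close> and let \<open>K\<close> be \<open>E\<close> minus its mean on each
  piece \<open>[j/n, (j+1)/n]\<close>. Since \<open>f\<close> minus its spline vanishes at the nodes, integration by parts on each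
  piece shows that the error functional is \<open>- \<integral> f' K\<close>. Its norm is the \<open>L2\<close> norm of \<open>K\<close>, and it is attained
  at a multiple of the conjugate of \<open>Q\<close> minus its spline, where \<open>Q\<close> is an antiderivative of \<open>E\<close>, because
  that difference has derivative \<open>K\<close>. On the functions that vanish at both end points the initial
  error is \<open>- \<integral> f' E\<close>, with the conjugate of \<open>Q - Q 0\<close> as extremal function. The limits and bounds then concern the function \<open>1 - (sin x / x)\<^sup>2\<close> at \<open>x = k * pi / n\<close>.
\<close>

section \<open>Absolutely continuous functions\<close>

lemma absolutely_continuous_onD:
  assumes f: "absolutely_continuous_on S f" and \<epsilon>: "\<epsilon> > 0"
  obtains \<delta> where "\<delta> > 0"
    "\<And>d t. d division_of t \<Longrightarrow> t \<subseteq> S \<Longrightarrow> (\<Sum>u\<in>d. Sup u - Inf u) < \<delta> \<Longrightarrow>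
       (\<Sum>u\<in>d. norm (f (Sup u) - f (Inf u))) < \<epsilon>"
proof -
  obtain \<delta> where \<delta>: "\<delta> > 0" and "\<forall>d t. d division_of t \<and> t \<subseteq> S \<and> (\<Sum>u\<in>d. Sup u - Inf u) < \<delta> \<longrightarrow>
       (\<Sum>u\<in>d. norm (f (Sup u) - f (Inf u))) < \<epsilon>"
    using f[unfolded absolutely_continuous_on_def, rule_format, OF \<epsilon>] by (elim exE conjE)
  then show thesis by (intro that[OF \<delta>]) (elim allE impE; (intro conjI)?; assumption)
qed

lemma absolutely_continuous_on_subset:
  assumes "absolutely_continuous_on S f" "T \<subseteq> S"
  shows "absolutely_continuous_on T f"
  unfolding absolutely_continuous_on_def
proof (intro allI impI)
  fix \<epsilon> :: real assume "\<epsilon> > 0"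
  obtain \<delta> where \<delta>: "\<delta> > 0"
    "\<And>d t. d division_of t \<Longrightarrow> t \<subseteq> S \<Longrightarrow> (\<Sum>u\<in>d. Sup u - Inf u) < \<delta> \<Longrightarrow>
       (\<Sum>u\<in>d. norm (f (Sup u) - f (Inf u))) < \<epsilon>" by (rule absolutely_continuous_onD[OF assms(1) \<open>\<epsilon> > 0\<close>]) (rule that)
  show "\<exists>\<delta>>0. \<forall>d t. d division_of t \<and> t \<subseteq> T \<and> (\<Sum>u\<in>d. Sup u - Inf u) < \<delta> \<longrightarrow>
       (\<Sum>u\<in>d. norm (f (Sup u) - f (Inf u))) < \<epsilon>"
    using \<delta>(1) \<delta>(2)[OF _ order_trans[OF _ assms(2)]] by (intro exI[of _ \<delta>] conjI allI impI) (assumption, elim conjE, assumption)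
qed

lemma division_of_real_member:
  fixes t :: "real set"
  assumes "d division_of t" "u \<in> d"
  shows "Inf u \<in> t" "Sup u \<in> t" "Inf u \<le> Sup u" "u = {Inf u..Sup u}"
proof -
  obtain a b where u: "u = cbox a b" "u \<noteq> {}" "u \<subseteq> t"
    using division_ofD[OF assms(1)] assms(2) by metis
  then have "a \<le> b" by auto
  then show "Inf u \<in> t" "Sup u \<in> t" "Inf u \<le> Sup u" "u = {Inf u..Sup u}"
    using u by auto
qed

lemma lipschitz_imp_absolutely_continuous_on:
  fixes f :: "real \<Rightarrow> 'a::real_normed_vector"
  assumes "L-lipschitz_on S f"
  shows "absolutely_continuous_on S f"
  unfolding absolutely_continuous_on_def
proof (intro allI impI)
  fix \<epsilon> :: real assume e: "\<epsilon> > 0"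
  have L: "L \<ge> 0" using assms lipschitz_on_nonneg by blast
  show "\<exists>\<delta>>0. \<forall>d t. d division_of t \<and> t \<subseteq> S \<and> (\<Sum>u\<in>d. Sup u - Inf u) < \<delta> \<longrightarrow>
        (\<Sum>u\<in>d. norm (f (Sup u) - f (Inf u))) < \<epsilon>"
  \<comment> \<open>The summand 1 keeps the quotient meaningful when \<open>L = 0\<close>.\<close>
  proof (intro exI[of _ "\<epsilon> / (L + 1)"] conjI allI impI)
    fix d t assume d: "d division_of t \<and> t \<subseteq> S \<and> (\<Sum>u\<in>d. Sup u - Inf u) < \<epsilon> / (L + 1)"
    have "(\<Sum>u\<in>d. norm (f (Sup u) - f (Inf u))) \<le> (\<Sum>u\<in>d. (L + 1) * (Sup u - Inf u))"
    proof (rule sum_mono)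
      fix u assume u: "u \<in> d"
      have "norm (f (Sup u) - f (Inf u)) \<le> L * (Sup u - Inf u)"
        using lipschitz_onD[OF assms, of "Sup u" "Inf u"] division_of_real_member(1-3)[OF conjunct1[OF d] u] d
        by (auto simp: dist_norm subset_iff)
      also have "\<dots> \<le> (L + 1) * (Sup u - Inf u)"
        using division_of_real_member(3)[OF conjunct1[OF d] u] by (intro mult_right_mono) auto
      finally show "norm (f (Sup u) - f (Inf u)) \<le> (L + 1) * (Sup u - Inf u)" .
    qed
    also have "\<dots> < \<epsilon>"
      unfolding sum_distrib_left[symmetric] using d L by (simp add: pos_less_divide_eq mult.commute)
    finally show "(\<Sum>u\<in>d. norm (f (Sup u) - f (Inf u))) < \<epsilon>" .
  qed (use e L in auto)
qed

lemma absolutely_continuous_on_imp_continuous_on: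
  fixes f :: "real \<Rightarrow> 'a::real_normed_vector"
  assumes "absolutely_continuous_on {a..b} f"
  shows "continuous_on {a..b} f"
  unfolding continuous_on_iff
proof (intro ballI allI impI)
  fix x \<epsilon> :: real assume x: "x \<in> {a..b}" and e: "0 < \<epsilon>"
  obtain \<delta> where \<delta>: "\<delta> > 0" and
    *: "\<And>d t. d division_of t \<Longrightarrow> t \<subseteq> {a..b} \<Longrightarrow> (\<Sum>u\<in>d. Sup u - Inf u) < \<delta> \<Longrightarrow>
       (\<Sum>u\<in>d. norm (f (Sup u) - f (Inf u))) < \<epsilon>"
    by (rule absolutely_continuous_onD[OF assms e]) (rule that)
  have **: "norm (f z - f y) < \<epsilon>" if "y \<in> {a..b}" "z \<in> {a..b}" "y \<le> z" "z - y < \<delta>" for y z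
  proof -
    \<comment> \<open>A family with a single interval already controls one increment of
      \<open>f\<close>, which is uniform continuity.\<close>
    have "{cbox y z} division_of cbox y z"
      using that by (intro division_of_self) auto
    from *[OF this] show ?thesis using that by auto
  qed
  show "\<exists>d>0. \<forall>x'\<in>{a..b}. dist x' x < d \<longrightarrow> dist (f x') (f x) < \<epsilon>"
  proof (intro exI[of _ \<delta>] conjI ballI impI \<delta>)
    fix y assume y: "y \<in> {a..b}" "dist y x < \<delta>"
    show "dist (f y) (f x) < \<epsilon>"
      using **[of x y] **[of y x] x y
      by (cases "x \<le> y") (auto simp: dist_norm norm_minus_commute)
  qed
qed

lemma absolutely_continuous_on_mult:
  fixes f g :: "real \<Rightarrow> 'a::real_normed_algebra"
  assumes f: "absolutely_continuous_on {a..b} f" and g: "absolutely_continuous_on {a..b} g"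
  shows "absolutely_continuous_on {a..b} (\<lambda>x. f x * g x)"
  unfolding absolutely_continuous_on_def
proof (intro allI impI)
  fix \<epsilon> :: real assume e0: "0 < \<epsilon>"
  have "bounded (f ` {a..b})" "bounded (g ` {a..b})"
    using f g by (metis absolutely_continuous_on_imp_continuous_on compact_Icc
        compact_continuous_image compact_imp_bounded)+
  then obtain B C where B: "B > 0" "\<And>x. x \<in> {a..b} \<Longrightarrow> norm (f x) \<le> B"
    and C: "C > 0" "\<And>x. x \<in> {a..b} \<Longrightarrow> norm (g x) \<le> C"
    unfolding bounded_pos ball_simps by meson
  \<comment> \<open>The tolerance for each factor is scaled by the bound of the other one, so that
    each of the two terms of the product increment costs \<open>\<epsilon> / 2\<close>.\<close>
  have e: "0 < \<epsilon> / (2 * C)" "0 < \<epsilon> / (2 * B)" using e0 B(1) C(1) by simp_all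
  obtain \<delta>1 where 1: "\<delta>1 > 0" "\<And>d t. d division_of t \<Longrightarrow> t \<subseteq> {a..b} \<Longrightarrow> (\<Sum>u\<in>d. Sup u - Inf u) < \<delta>1 \<Longrightarrow>
       (\<Sum>u\<in>d. norm (f (Sup u) - f (Inf u))) < \<epsilon> / (2 * C)"
    by (rule absolutely_continuous_onD[OF f e(1)]) (rule that)
  obtain \<delta>2 where 2: "\<delta>2 > 0" "\<And>d t. d division_of t \<Longrightarrow> t \<subseteq> {a..b} \<Longrightarrow> (\<Sum>u\<in>d. Sup u - Inf u) < \<delta>2 \<Longrightarrow>
       (\<Sum>u\<in>d. norm (g (Sup u) - g (Inf u))) < \<epsilon> / (2 * B)"
    by (rule absolutely_continuous_onD[OF g e(2)]) (rule that)
  show "\<exists>\<delta>>0. \<forall>d t. d division_of t \<and> t \<subseteq> {a..b} \<and> (\<Sum>u\<in>d. Sup u - Inf u) < \<delta> \<longrightarrow>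
        (\<Sum>u\<in>d. norm (f (Sup u) * g (Sup u) - f (Inf u) * g (Inf u))) < \<epsilon>"
  proof (intro exI[of _ "min \<delta>1 \<delta>2"] conjI allI impI)
    fix d t assume d: "d division_of t \<and> t \<subseteq> {a..b} \<and> (\<Sum>u\<in>d. Sup u - Inf u) < min \<delta>1 \<delta>2"
    have "(\<Sum>u\<in>d. norm (f (Sup u) * g (Sup u) - f (Inf u) * g (Inf u))) \<le>
      (\<Sum>u\<in>d. norm (f (Sup u) - f (Inf u)) * C + B * norm (g (Sup u) - g (Inf u)))"
    proof (rule sum_mono)
      fix u assume u: "u \<in> d"
      have m: "Inf u \<in> {a..b}" "Sup u \<in> {a..b}"
        using division_of_real_member(1,2)[OF conjunct1[OF d] u] d by blast+
      have "f (Sup u) * g (Sup u) - f (Inf u) * g (Inf u) =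
        (f (Sup u) - f (Inf u)) * g (Sup u) + f (Inf u) * (g (Sup u) - g (Inf u))"
        by (simp add: algebra_simps)
      also have "norm \<dots> \<le> norm (f (Sup u) - f (Inf u)) * norm (g (Sup u)) + norm (f (Inf u)) * norm (g (Sup u) - g (Inf u))"
        by (intro norm_triangle_le add_mono norm_mult_ineq)
      also have "\<dots> \<le> norm (f (Sup u) - f (Inf u)) * C + B * norm (g (Sup u) - g (Inf u))"
        using B(2)[OF m(1)] C(2)[OF m(2)] by (intro add_mono mult_left_mono mult_right_mono) auto
      finally show "norm (f (Sup u) * g (Sup u) - f (Inf u) * g (Inf u)) \<le>
        norm (f (Sup u) - f (Inf u)) * C + B * norm (g (Sup u) - g (Inf u))" .
    qed
    also have "\<dots> = (\<Sum>u\<in>d. norm (f (Sup u) - f (Inf u))) * C + B * (\<Sum>u\<in>d. norm (g (Sup u) - g (Inf u)))"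
      by (simp add: sum.distrib sum_distrib_left sum_distrib_right)
    also have "\<dots> < \<epsilon> / (2 * C) * C + B * (\<epsilon> / (2 * B))"
      using 1(2)[of d t] 2(2)[of d t] d B(1) C(1)
      by (intro add_strict_mono mult_strict_right_mono mult_strict_left_mono) auto
    also have "\<dots> = \<epsilon>" using B(1) C(1) by simp
    finally show "(\<Sum>u\<in>d. norm (f (Sup u) * g (Sup u) - f (Inf u) * g (Inf u))) < \<epsilon>" .
  qed (use 1(1) 2(1) in auto)
qed

section \<open>The fundamental theorem of calculus for absolutely continuous functions\<close>

text \<open>Integrating the constant 1 over the division turns its total length into a measure. In
  this way a cover of small measure meets the smallness condition in the definition of absolute
  continuity.\<close>

lemma sum_length_division_le_measure:
  fixes t :: "real set"
  assumes d: "d division_of t" and U: "t \<subseteq> U" "U \<in> lmeasurable"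
  shows "(\<Sum>u\<in>d. Sup u - Inf u) \<le> measure lebesgue U"
proof -
  have "t = \<Union>d" "finite d" using division_ofD[OF d] by blast+
  have "compact t"
    unfolding \<open>t = \<Union>d\<close> using \<open>finite d\<close> division_ofD(4)[OF d] by (intro compact_Union) (metis compact_cbox)+
  then have t: "t \<in> lmeasurable" by (rule lmeasurable_compact)
  have "((\<lambda>x. 1::real) has_integral (\<Sum>u\<in>d. Sup u - Inf u)) t"
  proof (rule has_integral_combine_division[OF d])
    fix k assume k: "k \<in> d"
    have "((\<lambda>x. 1::real) has_integral (Sup k - Inf k)) {Inf k..Sup k}"
      using has_integral_const_real[of "1::real" "Inf k" "Sup k"]
        division_of_real_member(3)[OF d k] by simp
    then show "((\<lambda>x. 1::real) has_integral (Sup k - Inf k)) k"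
      using division_of_real_member(4)[OF d k] by simp
  qed
  then have "(\<Sum>u\<in>d. Sup u - Inf u) = measure lebesgue t"
    using lmeasure_integral[OF t] by (metis integral_unique)
  also have "\<dots> \<le> measure lebesgue U"
    using U t by (intro measure_mono_fmeasurable) (auto simp: fmeasurableD)
  finally show ?thesis .
qed

text \<open>Henstock--Kurzweil argument: tags outside \<open>N\<close> are handled by differentiability, and those in
  \<open>N\<close> by a gauge that forces their intervals into an open set of small measure.\<close>

theorem absolutely_continuous_has_integral:
  fixes f :: "real \<Rightarrow> 'a::banach"
  assumes ab: "a \<le> b" and ac: "absolutely_continuous_on {a..b} f" and N: "negligible N"
    and deriv: "\<And>x. x \<in> {a..b} - N \<Longrightarrow> (f has_vector_derivative f' x) (at x within {a..b})"
  shows "(f' has_integral (f b - f a)) {a..b}"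
proof -
  \<comment> \<open>The value 0 on \<open>N\<close> reduces the error term of a tag in
    \<open>N\<close> to the increment of \<open>f\<close>, the quantity that absolute continuity
    controls.\<close>
  define g where "g x = (if x \<in> N then 0 else f' x)" for x
  have "(g has_integral (f b - f a)) (cbox a b)"
    unfolding has_integral
  proof (intro allI impI)
    fix \<epsilon> :: real assume e0: "0 < \<epsilon>"
    \<comment> \<open>The extra 1 keeps the denominator positive if \<open>a = b\<close>. The tags
      outside \<open>N\<close> then cost less than \<open>\<epsilon> / 2\<close> in total.\<close>
    define e where "e = \<epsilon> / (2 * (b - a + 1))"
    have "\<epsilon> * (b - a) < \<epsilon> * (b - a + 1)" using e0 by simp
    then have e: "e > 0" "e * (b - a) < \<epsilon> / 2"
      using e0 ab by (simp_all add: e_def pos_divide_less_eq)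
    obtain \<delta> where \<delta>: "\<delta> > 0" and
      *: "\<And>d t. d division_of t \<Longrightarrow> t \<subseteq> {a..b} \<Longrightarrow> (\<Sum>u\<in>d. Sup u - Inf u) < \<delta> \<Longrightarrow>
         (\<Sum>u\<in>d. norm (f (Sup u) - f (Inf u))) < \<epsilon> / 2"
      by (rule absolutely_continuous_onD[OF ac half_gt_zero[OF e0]]) (rule that)
    have null: "N \<in> null_sets lebesgue" using N by (simp add: negligible_iff_null_sets)
    then have "N \<in> sets lebesgue" by blast
    then obtain U where "open U" "N \<subseteq> U" and U': "U - N \<in> lmeasurable" "emeasure lebesgue (U - N) < \<delta>"
      using sets_lebesgue_outer_open \<delta> by metis
    moreover have Um: "U \<in> lmeasurable"
      using null U'(1) \<open>open U\<close>
      by (metis borel_open measurable_Diff_null_set sets_completionI_sets sets_lborel)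
    moreover have "measure lebesgue (U - N) = measure lebesgue U"
      using Um null by (simp add: fmeasurableD measure_Diff_null_set)
    then have "measure lebesgue U < \<delta>"
      using U' by (simp add: emeasure_eq_measure2 ennreal_less_iff)
    ultimately have U: "open U" "N \<subseteq> U" "U \<in> lmeasurable" "measure lebesgue U < \<delta>" by auto
    have "\<exists>r>0. \<forall>y\<in>{a..b}. norm (y - x) < r \<longrightarrow> norm (f y - f x - (y - x) *\<^sub>R f' x) \<le> e * norm (y - x)"
      if "x \<in> {a..b} - N" for x
      using deriv[OF that] e unfolding has_vector_derivative_def has_derivative_within_alt by blast
    then obtain r where r: "\<And>x. x \<in> {a..b} - N \<Longrightarrow> r x > 0"
      "\<And>x y. x \<in> {a..b} - N \<Longrightarrow> y \<in> {a..b} \<Longrightarrow> norm (y - x) < r x \<Longrightarrow>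
         norm (f y - f x - (y - x) *\<^sub>R f' x) \<le> e * norm (y - x)"
      by metis
    define \<gamma> where "\<gamma> x = (if x \<in> N then U else if x \<in> {a..b} then ball x (r x) else ball x 1)" for x
    show "\<exists>\<gamma>. gauge \<gamma> \<and> (\<forall>D. D tagged_division_of cbox a b \<and> \<gamma> fine D \<longrightarrow>
             norm ((\<Sum>(x,k)\<in>D. measure lborel k *\<^sub>R g x) - (f b - f a)) < \<epsilon>)"
    proof (intro exI[of _ \<gamma>] conjI allI impI)
      show "gauge \<gamma>"
        using U r(1) by (auto simp: gauge_def \<gamma>_def)
      fix D assume D: "D tagged_division_of cbox a b \<and> \<gamma> fine D"
      then have Dd: "D tagged_division_of {a..b}" and fine: "\<gamma> fine D" by auto
      note tD = tagged_division_ofD[OF Dd]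
      have finD: "finite D" using tD(1) .
      define D2 where "D2 = {(x,k) \<in> D. x \<in> N}"
      \<comment> \<open>\<open>Sup\<close> and \<open>Inf\<close> of the empty set are unspecified,
        hence the default 0: the later passage from tagged to untagged intervals needs
        \<open>h\<close> to vanish on every box with empty interior.\<close>
      define h where "h k = (if k = {} then 0 else norm (f (Sup k) - f (Inf k)))" for k
      have D2: "D2 \<subseteq> D" by (auto simp: D2_def)
      have "D2 tagged_partial_division_of {a..b}"
        using Dd D2 tagged_partial_division_subset tagged_division_of_def by blast
      note self = tagged_partial_division_of_Union_self[OF this]
      have div2: "snd ` D2 division_of \<Union>(snd ` D2)"
        using division_of_tagged_division[OF self] .
      have sub2: "\<Union>(snd ` D2) \<subseteq> {a..b}" using D2 tD(3) by fastforce
      have sub2U: "\<Union>(snd ` D2) \<subseteq> U"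
      proof
        fix y assume "y \<in> \<Union>(snd ` D2)"
        then obtain x k where k: "(x,k) \<in> D" "x \<in> N" "y \<in> k" by (auto simp: D2_def)
        then have "k \<subseteq> \<gamma> x" using fine by (meson fineD)
        then show "y \<in> U" using k by (auto simp: \<gamma>_def)
      qed
      have bound: "norm (measure lborel k *\<^sub>R g x - (f (Sup k) - f (Inf k))) \<le>
                    e * measure lborel k + (if (x,k) \<in> D2 then h k else 0)" if xk: "(x,k) \<in> D" for x k
      proof -
        obtain u v where k: "k = cbox u v" using tD(4)[OF xk] by auto
        have xin: "x \<in> k" "k \<subseteq> {a..b}" using tD(2,3)[OF xk] by auto
        then have uv: "u \<le> x" "x \<le> v" "u \<in> {a..b}" "v \<in> {a..b}" "x \<in> {a..b}"
          using k by auto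
        have si: "Sup k = v" "Inf k = u" "measure lborel k = v - u" using uv k by auto
        show ?thesis
        proof (cases "x \<in> N")
          case True
          then have "(x,k) \<in> D2" using xk by (simp add: D2_def)
          with True show ?thesis using e uv si xin by (auto simp: g_def h_def norm_minus_commute)
        next
          case False
          then have x: "x \<in> {a..b} - N" using uv by auto
          have "k \<subseteq> ball x (r x)" using fineD[OF fine xk] x by (simp add: \<gamma>_def)
          moreover have "u \<in> k" "v \<in> k" using k uv by auto
          ultimately have "u \<in> ball x (r x)" "v \<in> ball x (r x)" by blast+
          then have near: "norm (u - x) < r x" "norm (v - x) < r x"
            by (simp_all add: dist_norm norm_minus_commute)
          \<comment> \<open>Straddle argument: the tag lies between \<open>u\<close> and
            \<open>v\<close>, so the linearisation errors at the two ends are bounded by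
            \<open>e\<close> times \<open>x - u\<close> and \<open>e\<close> times
            \<open>v - x\<close>, which add up to \<open>e\<close> times the length.\<close>
          have "norm (measure lborel k *\<^sub>R g x - (f (Sup k) - f (Inf k))) =
            norm ((f u - f x - (u - x) *\<^sub>R f' x) - (f v - f x - (v - x) *\<^sub>R f' x))"
            using False by (simp add: si g_def algebra_simps)
          also have "\<dots> \<le> e * norm (u - x) + e * norm (v - x)"
            using r(2)[OF x uv(3) near(1)] r(2)[OF x uv(4) near(2)]
            by (meson add_mono norm_triangle_ineq4 order_trans)
          also have "\<dots> = e * measure lborel k" using uv by (simp add: si algebra_simps)
          finally show ?thesis using False by (simp add: D2_def)
        qed
      qed
      have "(\<Sum>(x,k)\<in>D. measure lborel k *\<^sub>R g x) - (f b - f a) =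
        (\<Sum>(x,k)\<in>D. measure lborel k *\<^sub>R g x - (f (Sup k) - f (Inf k)))"
        unfolding additive_tagged_division_1[OF ab Dd, of f, symmetric]
        by (simp add: sum_subtractf[symmetric] case_prod_unfold)
      also have "norm \<dots> \<le> (\<Sum>(x,k)\<in>D. e * measure lborel k + (if (x,k) \<in> D2 then h k else 0))"
        by (rule sum_norm_le) (use bound in auto)
      also have "\<dots> = e * (\<Sum>(x,k)\<in>D. measure lborel k) + (\<Sum>(x,k)\<in>D. if (x,k) \<in> D2 then h k else 0)"
        by (simp add: sum.distrib sum_distrib_left case_prod_unfold)
      also have "(\<Sum>(x,k)\<in>D. measure lborel k) = b - a"
        using additive_content_tagged_division[of D a b] Dd ab by simp
      also have "(\<Sum>(x,k)\<in>D. if (x,k) \<in> D2 then h k else 0) = (\<Sum>(x,k)\<in>D2. h k)"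
        using sum.inter_restrict[OF finD, of "\<lambda>p. h (snd p)" D2] D2
        by (simp add: case_prod_unfold Int_absorb1)
      \<comment> \<open>Two different tags can share an interval only if its interior is empty, and
        there \<open>h\<close> is 0.\<close>
      also have "\<dots> = sum h (snd ` D2)"
        by (rule sum.over_tagged_division_lemma[OF self])
          (auto simp: h_def box_eq_empty dest: order.antisym)
      also have "\<dots> \<le> (\<Sum>k\<in>snd ` D2. norm (f (Sup k) - f (Inf k)))"
        by (rule sum_mono) (simp add: h_def)
      also have "\<dots> < \<epsilon> / 2"
        using sum_length_division_le_measure[OF div2 sub2U U(3)] U(4)
        by (intro *[OF div2 sub2]) auto
      finally show "norm ((\<Sum>(x,k)\<in>D. measure lborel k *\<^sub>R g x) - (f b - f a)) < \<epsilon>"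
        using e by linarith
    qed
  qed
  then have "(g has_integral (f b - f a)) {a..b}" by simp
  then show ?thesis
    by (rule has_integral_spike[OF N, rotated]) (simp add: g_def)
qed

section \<open>The space H1 and functionals represented by a kernel\<close>

text \<open>Restates almost-everywhere differentiability through a negligible exceptional set, the
  form that \<open>absolutely_continuous_has_integral\<close> asks for.\<close>

lemma H1_has_vector_derivative:
  assumes "f \<in> H1"
  obtains N where "negligible N"
    "\<And>x. x \<in> {0..1} - N \<Longrightarrow> (f has_vector_derivative deriv01 f x) (at x within {0..1})"
proof -
  have "AE x in lebesgue. x \<in> {0..1} \<longrightarrow> f differentiable (at x within {0..1})"
    using assms by (auto simp: H1_def AE_restrict_space_iff)
  then obtain N where N: "N \<in> null_sets lebesgue"
    "{x \<in> space lebesgue. \<not> (x \<in> {0..1} \<longrightarrow> f differentiable (at x within {0..1}))} \<subseteq> N"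
    unfolding eventually_ae_filter by blast
  show thesis
  proof (rule that)
    show "negligible N" using N by (simp add: negligible_iff_null_sets)
    fix x :: real assume "x \<in> {0..1} - N"
    then have "f differentiable (at x within {0..1})" using N by auto
    then show "(f has_vector_derivative deriv01 f x) (at x within {0..1})"
      by (simp add: deriv01_def vector_derivative_works)
  qed
qed

lemma H1_continuous_on: "f \<in> H1 \<Longrightarrow> continuous_on {0..1} f"
  by (simp add: H1_def absolutely_continuous_on_imp_continuous_on)

text \<open>The product \<open>f x * g x\<close> is again absolutely continuous and obeys the
  product rule off the exceptional set of \<open>f\<close>, so the fundamental theorem applies to
  it. Arbitrary subintervals are allowed because the kernel jumps at the nodes.\<close>

lemma H1_integration_by_parts:
  assumes f: "f \<in> H1" and ab: "0 \<le> a" "a \<le> b" "b \<le> 1"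
    and ac: "absolutely_continuous_on {a..b} g"
    and g: "\<And>x. x \<in> {a..b} \<Longrightarrow> (g has_vector_derivative g' x) (at x within {a..b})"
  shows "((\<lambda>x. deriv01 f x * g x + f x * g' x) has_integral (f b * g b - f a * g a)) {a..b}"
proof -
  obtain N where N: "negligible N"
    "\<And>x. x \<in> {0..1} - N \<Longrightarrow> (f has_vector_derivative deriv01 f x) (at x within {0..1})"
    by (rule H1_has_vector_derivative[OF f]) (rule that)
  have sub: "{a..b} \<subseteq> {0..1}" using ab by auto
  have "absolutely_continuous_on {0..1} f" using f by (simp add: H1_def)
  then have "absolutely_continuous_on {a..b} f"
    using sub by (rule absolutely_continuous_on_subset)
  then have "absolutely_continuous_on {a..b} (\<lambda>x. f x * g x)"
    using ac by (rule absolutely_continuous_on_mult)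
  then have "((\<lambda>x. f x * g' x + deriv01 f x * g x) has_integral (f b * g b - f a * g a)) {a..b}"
  proof (rule absolutely_continuous_has_integral[OF ab(2) _ N(1)])
    fix x assume x: "x \<in> {a..b} - N"
    then have "(f has_vector_derivative deriv01 f x) (at x within {a..b})"
      using has_vector_derivative_within_subset[OF N(2) sub] sub by auto
    then show "((\<lambda>x. f x * g x) has_vector_derivative (f x * g' x + deriv01 f x * g x)) (at x within {a..b})"
      using g[of x] x by (intro has_vector_derivative_mult) auto
  qed
  then show ?thesis by (simp add: add.commute)
qed

section \<open>Lipschitz functions as members of H1\<close>

lemma C1_lipschitz:
  fixes f :: "real \<Rightarrow> 'a::real_normed_vector"
  assumes "\<And>x. x \<in> {a..b} \<Longrightarrow> (f has_vector_derivative f' x) (at x within {a..b})"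
    and "\<And>x. x \<in> {a..b} \<Longrightarrow> norm (f' x) \<le> B" and "0 \<le> B"
  shows "B-lipschitz_on {a..b} f"
proof (rule bounded_derivative_imp_lipschitz)
  show "(f has_derivative (\<lambda>h. h *\<^sub>R f' x)) (at x within {a..b})" if "x \<in> {a..b}" for x
    using assms(1)[OF that] by (simp add: has_vector_derivative_def)
  show "onorm (\<lambda>h. h *\<^sub>R f' x) \<le> B" if "x \<in> {a..b}" for x
    using assms(2)[OF that] \<open>0 \<le> B\<close>
    by (intro onorm_bound) (auto simp: mult.commute[of B] intro!: mult_left_mono)
qed (use assms in auto)

text \<open>Membership test for the extremal functions, which are smooth except for finitely many
  kinks: a finite set is null, and a bounded measurable function on a space of finite measure is
  square integrable.\<close>

lemma lipschitz_in_H1: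
  assumes lip: "L-lipschitz_on {0..1} f" and X: "finite X"
    and deriv: "\<And>x. x \<in> {0..1} - X \<Longrightarrow> (f has_vector_derivative g x) (at x within {0..1})"
    and g: "g \<in> borel_measurable (lebesgue_on {0..1})" "\<And>x. norm (g x) \<le> B"
  shows "f \<in> H1" "AE x in lebesgue_on {0..1}. deriv01 f x = g x"
proof -
  have eq: "deriv01 f x = g x" if "x \<in> {0..1} - X" for x
    unfolding deriv01_def using vector_derivative_within_closed_interval[of 0 1 x f] deriv[OF that] that by auto
  have "X \<in> null_sets lebesgue" using X negligible_finite negligible_iff_null_sets by blast
  then have nX: "AE x in lebesgue_on {0..1}. x \<notin> X"
    by (subst AE_restrict_space_iff) (auto dest: AE_not_in)
  show AE: "AE x in lebesgue_on {0..1}. deriv01 f x = g x"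
    using AE_space nX by eventually_elim (use eq in auto)
  have meas: "deriv01 f \<in> borel_measurable (lebesgue_on {0..1})"
  \<comment> \<open>On \<open>X\<close> the value of \<open>deriv01 f\<close> is arbitrary; changing
    a function at countably many points preserves measurability.\<close>
  proof (rule measurable_discrete_difference[OF g(1), of "X \<inter> {0..1}"])
    show "countable (X \<inter> {0..1})" using X by (simp add: countable_finite)
  qed (use eq in \<open>auto simp: sets_restrict_space_iff\<close>)
  interpret finite_measure "lebesgue_on {0..1::real}"
    by (intro finite_measure_lebesgue_on) auto
  have "AE x in lebesgue_on {0..1}. norm ((norm (deriv01 f x))\<^sup>2) \<le> B\<^sup>2"
    using AE by eventually_elim (use g(2) in \<open>simp add: power_mono\<close>)
  then have int: "integrable (lebesgue_on {0..1}) (\<lambda>x. (norm (deriv01 f x))\<^sup>2)"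
    by (rule integrable_const_bound) (use meas in measurable)
  have "AE x in lebesgue_on {0..1}. f differentiable (at x within {0..1})"
    using AE_space nX
  proof eventually_elim
    case (elim x)
    then show ?case using deriv[of x] by (auto intro: differentiableI_vector)
  qed
  then show "f \<in> H1"
    using lipschitz_imp_absolutely_continuous_on[OF lip] meas int by (simp add: H1_def)
qed

section \<open>Norms of functionals given by a bounded kernel\<close>

lemma integrable_continuous_lebesgue_on:
  fixes f :: "real \<Rightarrow> 'b::euclidean_space"
  shows "continuous_on {a..b} f \<Longrightarrow> integrable (lebesgue_on {a..b}) f"
  by (intro absolutely_integrable_imp_integrable absolutely_integrable_continuous_real) auto

text \<open>The inequality \<open>a * B \<le> a^2 + B^2\<close> for non-negative \<open>a\<close>
  and \<open>B\<close> yields a dominating function, which is integrable because the interval has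
  finite measure.\<close>

lemma integrable_deriv01_mult:
  assumes f: "f \<in> H1" and K: "K \<in> borel_measurable (lebesgue_on {0..1})" "\<And>x. norm (K x) \<le> B"
  shows "integrable (lebesgue_on {0..1}) (\<lambda>x. deriv01 f x * K x)"
proof -
  interpret finite_measure "lebesgue_on {0..1::real}"
    by (intro finite_measure_lebesgue_on) auto
  have f2: "integrable (lebesgue_on {0..1}) (\<lambda>x. (norm (deriv01 f x))\<^sup>2)"
    and fm: "deriv01 f \<in> borel_measurable (lebesgue_on {0..1})"
    using f by (auto simp: H1_def)
  have B: "B \<ge> 0" using K(2) norm_ge_zero order_trans by blast
  show ?thesis
  proof (rule Bochner_Integration.integrable_bound)
    show "integrable (lebesgue_on {0..1}) (\<lambda>x. (norm (deriv01 f x))\<^sup>2 + B\<^sup>2)"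
      using f2 by simp
    show "(\<lambda>x. deriv01 f x * K x) \<in> borel_measurable (lebesgue_on {0..1})"
      using fm K(1) by measurable
    have "norm (deriv01 f x * K x) \<le> norm ((norm (deriv01 f x))\<^sup>2 + B\<^sup>2)" for x
    proof -
      have "norm (deriv01 f x * K x) \<le> norm (deriv01 f x) * B"
        using K(2)[of x] by (simp add: norm_mult mult_left_mono)
      also have "\<dots> \<le> (norm (deriv01 f x))\<^sup>2 + B\<^sup>2"
        using sum_squares_bound[of "norm (deriv01 f x)" B]
          mult_nonneg_nonneg[OF norm_ge_zero B, of "deriv01 f x"] by linarith
      finally show ?thesis by simp
    qed
    then show "AE x in lebesgue_on {0..1}. norm (deriv01 f x * K x) \<le> norm ((norm (deriv01 f x))\<^sup>2 + B\<^sup>2)"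
      by simp
  qed
qed

text \<open>L2 duality: the Cauchy-Schwarz inequality gives the upper bound, and \<open>f0\<close>,
  whose derivative is the normalised conjugate of \<open>K\<close>, has semi-norm 1 and attains it.
  Both the spline error and the initial error are instances.\<close>

lemma worst_case_error_eqI:
  assumes K: "K \<in> borel_measurable (lebesgue_on {0..1})" "\<And>x. norm (K x) \<le> B"
    and normK: "((\<lambda>x. (norm (K x))\<^sup>2) has_integral N\<^sup>2) {0..1}" and N: "N > 0"
    and F: "F \<subseteq> H1"
    and rep: "\<And>f. f \<in> F \<Longrightarrow> I f - A f = - (LINT x|lebesgue_on {0..1}. deriv01 f x * K x)"
    and f0: "f0 \<in> F" "AE x in lebesgue_on {0..1}. deriv01 f0 x = cnj (K x) / of_real N"
  shows "worst_case_error A I F = ereal N"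
proof -
  let ?M = "lebesgue_on {0..1::real}"
  interpret finite_measure ?M
    by (intro finite_measure_lebesgue_on) auto
  have K2: "integrable ?M (\<lambda>x. (norm (K x))\<^sup>2)"
    by (rule integrable_const_bound[of _ "B\<^sup>2"]) (use K in \<open>auto intro!: AE_I2 power_mono\<close>)
  have LK: "(LINT x|?M. (norm (K x))\<^sup>2) = N\<^sup>2"
    using has_integral_integral_lebesgue_on[OF K2] normK has_integral_unique by auto
  have upper: "norm (I f - A f) \<le> N" if f: "f \<in> F" "H1_seminorm f \<le> 1" for f
  proof -
    have f1: "f \<in> H1" using f F by auto
    have f2: "integrable ?M (\<lambda>x. (norm (deriv01 f x))\<^sup>2)" using f1 by (simp add: H1_def)
    have le1: "(LINT x|?M. (norm (deriv01 f x))\<^sup>2) \<le> 1"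
      using f(2) by (simp add: H1_seminorm_def)
    have "norm (I f - A f) \<le> (LINT x|?M. norm (deriv01 f x * K x))"
      unfolding rep[OF f(1)] norm_minus_cancel by (rule integral_norm_bound)
    \<comment> \<open>Cauchy-Schwarz through the weighted inequality
      \<open>a * b \<le> N / 2 * a^2 + b^2 / (2 * N)\<close>. With these weights each of the two
      integrals contributes at most \<open>N / 2\<close>.\<close>
    also have "\<dots> \<le> (LINT x|?M. N / 2 * (norm (deriv01 f x))\<^sup>2 + 1 / (2 * N) * (norm (K x))\<^sup>2)"
    proof (rule integral_mono)
      show "integrable ?M (\<lambda>x. norm (deriv01 f x * K x))"
        using integrable_deriv01_mult[OF f1 K] by (rule integrable_norm)
      show "integrable ?M (\<lambda>x. N / 2 * (norm (deriv01 f x))\<^sup>2 + 1 / (2 * N) * (norm (K x))\<^sup>2)"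
        using f2 K2 by simp
      fix x
      have "0 \<le> (N * norm (deriv01 f x) - norm (K x))\<^sup>2 / (2 * N)" using N by simp
      also have "\<dots> = N / 2 * (norm (deriv01 f x))\<^sup>2 + 1 / (2 * N) * (norm (K x))\<^sup>2 - norm (deriv01 f x * K x)"
        using N by (simp add: norm_mult field_simps power2_eq_square)
      finally show "norm (deriv01 f x * K x) \<le> N / 2 * (norm (deriv01 f x))\<^sup>2 + 1 / (2 * N) * (norm (K x))\<^sup>2"
        by simp
    qed
    also have "\<dots> = N / 2 * (LINT x|?M. (norm (deriv01 f x))\<^sup>2) + 1 / (2 * N) * N\<^sup>2"
      using f2 K2 by (simp add: LK)
    also have "\<dots> \<le> N / 2 * 1 + 1 / (2 * N) * N\<^sup>2"
      using N le1 by (intro add_mono mult_left_mono) auto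
    also have "\<dots> = N" using N by (simp add: power2_eq_square)
    finally show ?thesis .
  qed
  have "(LINT x|?M. (norm (deriv01 f0 x))\<^sup>2) = (LINT x|?M. (norm (K x))\<^sup>2 / N\<^sup>2)"
  proof (rule integral_cong_AE)
    show "AE x in ?M. (norm (deriv01 f0 x))\<^sup>2 = (norm (K x))\<^sup>2 / N\<^sup>2"
      using f0(2) by eventually_elim (simp add: norm_divide power_divide)
  qed (use K f0 F in \<open>auto simp: H1_def\<close>)
  then have semi: "H1_seminorm f0 = 1"
    using N by (simp add: H1_seminorm_def LK)
  have "(LINT x|?M. deriv01 f0 x * K x) = (LINT x|?M. of_real ((norm (K x))\<^sup>2 / N))"
  proof (rule integral_cong_AE)
    show "AE x in ?M. deriv01 f0 x * K x = of_real ((norm (K x))\<^sup>2 / N)"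
      using f0(2) by eventually_elim (simp only: of_real_divide complex_norm_square, simp add: mult.commute)
  qed (use K f0 F in \<open>auto simp: H1_def\<close>)
  also have "\<dots> = of_real N"
    by (simp only: integral_complex_of_real integral_divide_zero LK) (use N in \<open>simp add: power2_eq_square\<close>)
  finally have val: "norm (I f0 - A f0) = N" using rep[OF f0(1)] N by simp
  show ?thesis
    unfolding worst_case_error_def
  proof (rule SUP_eqI)
    fix y assume "\<And>f. f \<in> {f \<in> F. H1_seminorm f \<le> 1} \<Longrightarrow> ereal (norm (I f - A f)) \<le> y"
    from this[of f0] show "ereal N \<le> y" using f0 semi val by simp
  qed (use upper in auto)
qed

text \<open>Integration by parts delivers only the gauge integral of the sum. Since both summands
  are Lebesgue integrable, it splits into two Lebesgue integrals.\<close>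

lemma error_representation:
  assumes f: "f \<in> H1" and K: "K \<in> borel_measurable (lebesgue_on {0..1})" "\<And>x. norm (K x) \<le> B"
    and h: "continuous_on {0..1} h"
    and zero: "((\<lambda>x. deriv01 f x * K x + h x) has_integral 0) {0..1}"
  shows "(LINT x|lebesgue_on {0..1}. h x) = - (LINT x|lebesgue_on {0..1}. deriv01 f x * K x)"
proof -
  have "integrable (lebesgue_on {0..1}) h"
    using h by (rule integrable_continuous_lebesgue_on)
  moreover have "integrable (lebesgue_on {0..1}) (\<lambda>x. deriv01 f x * K x)"
    using integrable_deriv01_mult[OF f K] .
  ultimately have "((\<lambda>x. deriv01 f x * K x + h x) has_integral
      (LINT x|lebesgue_on {0..1}. deriv01 f x * K x) + (LINT x|lebesgue_on {0..1}. h x)) {0..1}"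
    by (intro has_integral_add has_integral_integral_lebesgue_on) auto
  with zero show ?thesis by (simp add: has_integral_unique eq_neg_iff_add_eq_0 add.commute)
qed

section \<open>The error kernel of the spline algorithm\<close>

definition freq :: "int \<Rightarrow> complex" where
  "freq k = - 2 * of_real pi * \<i> * of_int k"

text \<open>\<open>prim k i\<close> is the \<open>i\<close>-th antiderivative of the character \<open>exp (- 2 * pi * \<i> * k * x)\<close>.\<close>

definition prim :: "int \<Rightarrow> nat \<Rightarrow> real \<Rightarrow> complex" where
  "prim k i x = exp (freq k * of_real x) / freq k ^ i"

lemma freq_nonzero: "k \<noteq> 0 \<Longrightarrow> freq k \<noteq> 0"
  by (simp add: freq_def)

lemma norm_freq: "norm (freq k) = 2 * pi * \<bar>real_of_int k\<bar>"
  by (simp add: freq_def norm_mult)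

lemma norm_prim: "norm (prim k i x) = 1 / norm (freq k) ^ i"
  by (simp add: prim_def norm_divide norm_power norm_exp_eq_Re freq_def)

lemma prim_0: "prim k i 0 = 1 / freq k ^ i"
  by (simp add: prim_def)

text \<open>The character has period 1 because \<open>k\<close> is an integer. Together with
  \<open>prim_0\<close> this makes the extremal function of the initial error vanish at both end
  points.\<close>

lemma prim_1: "prim k i 1 = 1 / freq k ^ i"
proof -
  have "freq k = complex_of_real (2 * real_of_int (- k) * pi) * \<i>" by (simp add: freq_def)
  then have "exp (freq k) = 1"
    using exp_integer_2pi[of "of_int (- k)"] by (simp only: Ints_of_int)
  then show ?thesis by (simp add: prim_def)
qed

lemma fourier_integral_prim: "fourier_integral k f = (LINT x|lebesgue_on {0..1}. f x * prim k 0 x)"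
  by (simp add: fourier_integral_def prim_def freq_def)

lemma prim_has_vector_derivative:
  assumes "k \<noteq> 0"
  shows "(prim k (Suc i) has_vector_derivative prim k i x) (at x within S)"
proof -
  have "((\<lambda>z. exp (freq k * z) / freq k ^ Suc i) has_field_derivative
      exp (freq k * of_real x) / freq k ^ i) (at (of_real x))"
    using freq_nonzero[OF assms] by (auto intro!: derivative_eq_intros)
  from has_vector_derivative_real_field[OF this] show ?thesis
    by (simp add: prim_def[abs_def])
qed

lemma continuous_on_prim [continuous_intros]: "continuous_on S (prim k i)"
  unfolding prim_def[abs_def] divide_inverse by (intro continuous_intros)

lemma prim_lipschitz:
  assumes "k \<noteq> 0"
  shows "(1 / norm (freq k) ^ i)-lipschitz_on {a..b} (prim k (Suc i))"
  by (rule C1_lipschitz[OF prim_has_vector_derivative[OF assms]]) (simp_all add: norm_prim)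

section \<open>Decomposition into pieces and regularity of the spline\<close>

lemma has_integral_pieces:
  fixes f :: "real \<Rightarrow> 'a::banach"
  assumes n: "n \<ge> 1"
    and f: "\<And>j. j < n \<Longrightarrow> (f has_integral c j) {real j / real n..(real j + 1) / real n}"
  shows "(f has_integral (\<Sum>j<n. c j)) {0..1}"
proof -
  have "(f has_integral (\<Sum>j<m. c j)) {0..real m / real n}" if "m \<le> n" for m
    using that
  proof (induction m)
    case 0
    then show ?case by (simp add: has_integral_refl)
  next
    case (Suc m)
    have "(f has_integral (\<Sum>j<m. c j) + c m) {0..(real m + 1) / real n}"
      using Suc f[of m] by (intro has_integral_combine[of _ "real m / real n"])
        (auto simp: divide_right_mono)
    then show ?case by (simp add: add.commute)
  qed
  from this[of n] n show ?thesis by simp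
qed

lemma unit_interval_pieces:
  assumes n: "n \<ge> 1" and x: "x \<in> {0..1::real}"
  obtains j where "j < n" "x \<in> {real j / real n..(real j + 1) / real n}"
proof (cases "x = 1")
  case True
  \<comment> \<open>At the right end point the floor of \<open>n * x\<close> is \<open>n\<close>,
    which is not the index of a piece, so the last piece is named directly.\<close>
  show thesis by (rule that[of "n - 1"]) (use n True in \<open>auto simp: of_nat_diff field_simps\<close>)
next
  case False
  define j where "j = nat \<lfloor>real n * x\<rfloor>"
  have j: "real j \<le> real n * x" "real n * x < real j + 1"
    using x by (simp_all add: j_def)
  have "real n * x < real n * 1" using n x False by (intro mult_strict_left_mono) auto
  then have "j < n" using j by linarith
  moreover have "x \<in> {real j / real n..(real j + 1) / real n}"
    using j n by (auto simp: field_simps)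
  ultimately show thesis by (rule that)
qed

lemma linear_spline_piece_lipschitz:
  assumes n: "n \<ge> 1"
  shows "(real n * norm (f ((real j + 1) / real n) - f (real j / real n)))-lipschitz_on
      {real j / real n..(real j + 1) / real n} (linear_spline n f)"
proof (rule lipschitz_onI)
  fix x y assume xy: "x \<in> {real j / real n..(real j + 1) / real n}" "y \<in> {real j / real n..(real j + 1) / real n}"
  let ?d = "f ((real j + 1) / real n) - f (real j / real n)"
  have "linear_spline n f x - linear_spline n f y = of_real (real n * (x - y)) * ?d"
    unfolding linear_spline_on_piece[OF n xy(1)] linear_spline_on_piece[OF n xy(2)]
    by (simp add: algebra_simps)
  also have "norm \<dots> = real n * norm ?d * \<bar>x - y\<bar>"
    by (simp only: norm_mult norm_of_real abs_mult) simp
  finally show "dist (linear_spline n f x) (linear_spline n f y) \<le> real n * norm ?d * dist x y"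
    by (simp add: dist_norm)
qed simp

lemma linear_spline_lipschitz:
  assumes n: "n \<ge> 1"
  obtains L where "L-lipschitz_on {0..1} (linear_spline n f)"
proof
  \<comment> \<open>Any common bound for the slopes of the pieces serves; the sum dominates each of
    its terms.\<close>
  define L where "L = (\<Sum>j<n. real n * norm (f ((real j + 1) / real n) - f (real j / real n)))"
  show "L-lipschitz_on {0..1} (linear_spline n f)"
  proof (rule lipschitz_on_closed_Union)
    fix j assume "j \<in> {..<n}"
    then have "real n * norm (f ((real j + 1) / real n) - f (real j / real n)) \<le> L"
      unfolding L_def by (intro member_le_sum) auto
    then show "L-lipschitz_on {real j / real n..(real j + 1) / real n} (linear_spline n f)"
      using linear_spline_piece_lipschitz[OF n] lipschitz_on_le by blast
  next
    show "0 \<le> L" by (auto simp: L_def intro!: sum_nonneg)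
    show "{0..1} \<subseteq> (\<Union>j\<in>{..<n}. {real j / real n..(real j + 1) / real n})"
    proof
      fix x :: real assume "x \<in> {0..1}"
      then obtain j where "j < n" "x \<in> {real j / real n..(real j + 1) / real n}"
        by (rule unit_interval_pieces[OF n])
      then show "x \<in> (\<Union>j\<in>{..<n}. {real j / real n..(real j + 1) / real n})" by blast
    qed
  qed auto
qed

text \<open>The mean of \<open>prim k 1\<close> over the piece with index \<open>j\<close>.\<close>

definition piece_mean :: "int \<Rightarrow> nat \<Rightarrow> real \<Rightarrow> complex" where
  "piece_mean k n j = of_nat n * (prim k 2 ((j + 1) / real n) - prim k 2 (j / real n))"

text \<open>On the unit interval, up to its right end point, this is the projection of
  \<open>prim k 1\<close> onto the orthogonal complement of the functions that are constant on each
  piece, among them the derivatives of splines. The floor assigns each node to the piece on its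
  right, as in \<open>linear_spline\<close>.\<close>

definition kernel :: "int \<Rightarrow> nat \<Rightarrow> real \<Rightarrow> complex" where
  "kernel k n x = prim k 1 x - piece_mean k n (of_int \<lfloor>real n * x\<rfloor>)"

lemma kernel_on_piece:
  assumes "n \<ge> 1" "real j / real n \<le> x" "x < (real j + 1) / real n"
  shows "kernel k n x = prim k 1 x - piece_mean k n (real j)"
proof -
  have "real j \<le> real n * x" "real n * x < real j + 1"
    using assms by (auto simp: field_simps)
  then have "\<lfloor>real n * x\<rfloor> = int j" by linarith
  then show ?thesis by (simp add: kernel_def)
qed

lemma kernel_measurable: "kernel k n \<in> borel_measurable (lebesgue_on {0..1})"
proof -
  have [measurable]: "prim k i \<in> borel_measurable borel" for i
    by (intro borel_measurable_continuous_onI continuous_on_prim)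
  have "kernel k n \<in> borel_measurable borel"
    unfolding kernel_def[abs_def] piece_mean_def by measurable
  then show ?thesis
    by (intro measurable_restrict_space1 measurable_completion) simp
qed

text \<open>A crude uniform bound, for integrability and for membership of the extremal function in
  \<open>H1\<close>. The value of the error comes from the L2 norm instead.\<close>

lemma norm_kernel_le: "norm (kernel k n x) \<le> 1 / norm (freq k) + real n * (2 / (norm (freq k))\<^sup>2)"
proof -
  have "norm (piece_mean k n j) \<le> real n * (2 / (norm (freq k))\<^sup>2)" for j
    unfolding piece_mean_def norm_mult norm_of_nat
    using norm_triangle_ineq4[of "prim k 2 ((j + 1) / real n)" "prim k 2 (j / real n)"]
    by (intro mult_left_mono) (auto simp: norm_prim)
  then show ?thesis
    unfolding kernel_def by (intro order_trans[OF norm_triangle_ineq4] add_mono) (simp_all add: norm_prim)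
qed

section \<open>The L2 norm of the kernel\<close>

lemma prim_has_integral:
  assumes "k \<noteq> 0" "a \<le> b"
  shows "(prim k i has_integral (prim k (Suc i) b - prim k (Suc i) a)) {a..b}"
  using assms by (intro fundamental_theorem_of_calculus prim_has_vector_derivative)

text \<open>Moving to another piece multiplies the mean by a factor of modulus 1, so its modulus
  does not depend on \<open>j\<close>. The sine comes from
  \<open>\<bar>exp (\<i> * t) - 1\<bar> = 2 * \<bar>sin (t / 2)\<bar>\<close> at
  \<open>t = - 2 * pi * k / n\<close>.\<close>

lemma norm_piece_mean:
  assumes k: "k \<noteq> 0" and n: "n \<ge> 1"
  shows "(norm (piece_mean k n j))\<^sup>2 =
    (1 / norm (freq k))\<^sup>2 * ((real n)\<^sup>2 / ((real_of_int k)\<^sup>2 * pi\<^sup>2) * (sin (real_of_int k * pi / real n))\<^sup>2)"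
proof -
  let ?w = "freq k * of_real (1 / real n)" and ?t = "real_of_int k * pi / real n"
  have "piece_mean k n j = of_nat n * (exp (freq k * of_real (j / real n)) * (exp ?w - 1)) / (freq k)\<^sup>2"
    by (simp add: piece_mean_def prim_def add_divide_distrib ring_distribs exp_add diff_divide_distrib)
  then have "norm (piece_mean k n j) = real n * norm (exp ?w - 1) / (norm (freq k))\<^sup>2"
    by (simp add: norm_mult norm_divide norm_power norm_exp_eq_Re freq_def)
  moreover have "norm (exp ?w - 1) = 2 * \<bar>sin ?t\<bar>"
  proof -
    have "?w = \<i> * of_real (- 2 * ?t)" by (simp add: freq_def)
    then show ?thesis using dist_exp_i_1[of "- 2 * ?t"] by simp
  qed
  ultimately have "(norm (piece_mean k n j))\<^sup>2 = (real n * (2 * \<bar>sin ?t\<bar>) / (norm (freq k))\<^sup>2)\<^sup>2" by simp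
  also have "\<dots> = (1 / norm (freq k))\<^sup>2 * ((real n)\<^sup>2 / ((real_of_int k)\<^sup>2 * pi\<^sup>2) * (sin ?t)\<^sup>2)"
    using k by (simp add: norm_freq power_mult_distrib power_divide field_simps)
  finally show ?thesis .
qed

text \<open>Pythagoras on each piece: subtracting the mean \<open>m\<close> lowers the mean square
  by the square of \<open>norm m\<close>. As \<open>norm (prim k 1 x)\<close> is constant and
  \<open>norm m\<close> is the same for all pieces, every piece contributes equally.\<close>

lemma kernel_norm_has_integral:
  assumes k: "k \<noteq> 0" and n: "n \<ge> 1"
  shows "((\<lambda>x. (norm (kernel k n x))\<^sup>2) has_integral (1 / norm (freq k))\<^sup>2 *
     (1 - (real n)\<^sup>2 / ((real_of_int k)\<^sup>2 * pi\<^sup>2) * (sin (real_of_int k * pi / real n))\<^sup>2)) {0..1}"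
proof -
  define r where "r = (1 / norm (freq k))\<^sup>2 *
     (1 - (real n)\<^sup>2 / ((real_of_int k)\<^sup>2 * pi\<^sup>2) * (sin (real_of_int k * pi / real n))\<^sup>2)"
  have "((\<lambda>x. (norm (kernel k n x))\<^sup>2) has_integral (\<Sum>j<n. r / real n)) {0..1}"
  proof (rule has_integral_pieces[OF n])
    fix j assume "j < n"
    let ?a = "real j / real n" and ?b = "(real j + 1) / real n"
    let ?m = "piece_mean k n (real j)"
    have ab: "?a \<le> ?b" and len: "?b - ?a = 1 / real n" using n by (auto simp: field_simps)
    have "(prim k 1 has_integral (prim k 2 ?b - prim k 2 ?a)) {?a..?b}"
      using prim_has_integral[OF k ab, of 1] by (simp add: numeral_2_eq_2)
    also have "prim k 2 ?b - prim k 2 ?a = ?m / of_nat n" using n by (simp add: piece_mean_def)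
    finally have "((\<lambda>x. prim k 1 x \<bullet> ?m) has_integral (?m / of_nat n) \<bullet> ?m) {?a..?b}"
      using has_integral_linear[OF _ bounded_linear_inner_left[of ?m]] by (simp add: o_def)
    also have "(?m / of_nat n) \<bullet> ?m = (norm ?m)\<^sup>2 / real n"
    proof -
      have "?m / of_nat n = (1 / real n) *\<^sub>R ?m" by (simp add: scaleR_conv_of_real)
      then show ?thesis by (simp only: inner_scaleR_left power2_norm_eq_inner) simp
    qed
    finally have 1: "((\<lambda>x. prim k 1 x \<bullet> ?m) has_integral (norm ?m)\<^sup>2 / real n) {?a..?b}" .
    have 2: "((\<lambda>x. (1 / norm (freq k))\<^sup>2 + (norm ?m)\<^sup>2) has_integral ((1 / norm (freq k))\<^sup>2 + (norm ?m)\<^sup>2) / real n) {?a..?b}"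
      using has_integral_const_real[of "(1 / norm (freq k))\<^sup>2 + (norm ?m)\<^sup>2" ?a ?b] ab len by simp
    have "((\<lambda>x. (1 / norm (freq k))\<^sup>2 + (norm ?m)\<^sup>2 - 2 * (prim k 1 x \<bullet> ?m)) has_integral
        ((1 / norm (freq k))\<^sup>2 + (norm ?m)\<^sup>2) / real n - 2 * ((norm ?m)\<^sup>2 / real n)) {?a..?b}"
      by (intro has_integral_diff has_integral_mult_right 1 2)
    also have "((1 / norm (freq k))\<^sup>2 + (norm ?m)\<^sup>2) / real n - 2 * ((norm ?m)\<^sup>2 / real n) =
        ((1 / norm (freq k))\<^sup>2 - (norm ?m)\<^sup>2) / real n"
      by (simp add: add_divide_distrib diff_divide_distrib)
    also have "\<dots> = r / real n"
      unfolding r_def norm_piece_mean[OF k n] by (simp add: algebra_simps)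
    finally show "((\<lambda>x. (norm (kernel k n x))\<^sup>2) has_integral r / real n) {?a..?b}"
    \<comment> \<open>At the right end point the floor already selects the mean of the next piece,
      so this single point is discarded.\<close>
    proof (rule has_integral_spike_finite[of "{?b}", rotated 2])
      fix x assume "x \<in> {?a..?b} - {?b}"
      then have "kernel k n x = prim k 1 x - ?m" using n by (intro kernel_on_piece) auto
      then have "(norm (kernel k n x))\<^sup>2 = (norm (prim k 1 x))\<^sup>2 + (norm ?m)\<^sup>2 - 2 * (prim k 1 x \<bullet> ?m)"
        by (simp add: power2_norm_eq_inner inner_diff inner_commute)
      then show "(norm (kernel k n x))\<^sup>2 = (1 / norm (freq k))\<^sup>2 + (norm ?m)\<^sup>2 - 2 * (prim k 1 x \<bullet> ?m)"
        by (simp add: norm_prim)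
    qed simp
  qed
  then show ?thesis using n by (simp add: r_def)
qed

text \<open>On a piece the kernel is an antiderivative of the character, and so integration by parts
  applies to both \<open>f\<close> and its spline. Their boundary terms agree by interpolation, and
  the constant slope of the spline integrates against the kernel to 0.\<close>

lemma kernel_error_has_integral:
  assumes k: "k \<noteq> 0" and n: "n \<ge> 1" and f: "f \<in> H1"
  shows "((\<lambda>x. deriv01 f x * kernel k n x + (f x - linear_spline n f x) * prim k 0 x) has_integral 0) {0..1}"
proof -
  have "((\<lambda>x. deriv01 f x * kernel k n x + (f x - linear_spline n f x) * prim k 0 x) has_integral (\<Sum>j<n. 0)) {0..1}"
  proof (rule has_integral_pieces[OF n])
    fix j assume j: "j < n"
    define a where "a = real j / real n"
    define b where "b = (real j + 1) / real n"
    define m where "m = piece_mean k n (real j)"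
    define d where "d = of_nat n * (f b - f a)"
    define L where "L x = f a + of_real (real n * x - real j) * (f b - f a)" for x
    have n0: "real n > 0" using n by simp
    have ab: "0 \<le> a" "a \<le> b" "b \<le> 1" and len: "b - a = 1 / real n"
      using n j by (auto simp: a_def b_def field_simps)
    have g: "((\<lambda>x. prim k 1 x - m) has_vector_derivative prim k 0 x) (at x within {a..b})" for x
      using has_vector_derivative_diff[OF prim_has_vector_derivative[OF k, of 0] has_vector_derivative_const[of m]]
      by simp
    have "absolutely_continuous_on {a..b} (\<lambda>x. prim k 1 x - m)"
      by (rule lipschitz_imp_absolutely_continuous_on[OF C1_lipschitz[OF g, where B = 1]]) (simp_all add: norm_prim)
    note P1 = H1_integration_by_parts[OF f ab this g]
    have La: "L a = f a" and Lb: "L b = f b"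
      using n0 by (simp_all add: L_def a_def b_def)
    have dL: "(L has_vector_derivative d) (at x within {a..b})" for x
      unfolding L_def[abs_def] d_def has_vector_derivative_def
      by (rule derivative_eq_intros refl | simp add: scaleR_conv_of_real algebra_simps)+
    have P2: "((\<lambda>x. L x * prim k 0 x + d * (prim k 1 x - m)) has_integral
        (L b * (prim k 1 b - m) - L a * (prim k 1 a - m))) {a..b}"
      using ab(2) by (intro fundamental_theorem_of_calculus has_vector_derivative_mult dL g)
    have "((\<lambda>x. d * (prim k 1 x - m)) has_integral d * ((prim k 2 b - prim k 2 a) - (b - a) *\<^sub>R m)) {a..b}"
      using prim_has_integral[OF k ab(2), of 1] has_integral_const_real[of m a b] ab
      by (intro has_integral_mult_right has_integral_diff) (simp_all add: numeral_2_eq_2)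
    \<comment> \<open>The kernel has mean 0 on the piece, because \<open>m\<close> is the mean of
      \<open>prim k 1\<close> there.\<close>
    moreover have "(prim k 2 b - prim k 2 a) - (b - a) *\<^sub>R m = 0"
    proof -
      have "m = of_nat n * (prim k 2 b - prim k 2 a)" by (simp add: m_def piece_mean_def a_def b_def)
      then show ?thesis using n0 unfolding len by (simp add: scaleR_conv_of_real)
    qed
    ultimately have P3: "((\<lambda>x. d * (prim k 1 x - m)) has_integral 0) {a..b}" by simp
    \<comment> \<open>\<open>P1\<close> minus \<open>P2\<close> leaves the term with the slope
      \<open>d\<close>, which \<open>P3\<close> cancels; the boundary terms cancel by
      \<open>La\<close> and \<open>Lb\<close>.\<close>
    have "((\<lambda>x. deriv01 f x * (prim k 1 x - m) + (f x - L x) * prim k 0 x) has_integral 0) {a..b}"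
      using has_integral_add[OF has_integral_diff[OF P1 P2] P3]
      by (simp add: La Lb algebra_simps)
    then have "((\<lambda>x. deriv01 f x * kernel k n x + (f x - linear_spline n f x) * prim k 0 x) has_integral 0) {a..b}"
    proof (rule has_integral_spike_finite[of "{b}", rotated 2])
      fix x assume x: "x \<in> {a..b} - {b}"
      then have "kernel k n x = prim k 1 x - m" 
        unfolding m_def using n by (intro kernel_on_piece) (auto simp: a_def b_def)
      moreover have "linear_spline n f x = L x"
        unfolding L_def using linear_spline_on_piece[OF n, of x j f] x by (auto simp: a_def b_def)
      ultimately show "deriv01 f x * kernel k n x + (f x - linear_spline n f x) * prim k 0 x =
          deriv01 f x * (prim k 1 x - m) + (f x - L x) * prim k 0 x" by simp
    qed simp
    then show "((\<lambda>x. deriv01 f x * kernel k n x + (f x - linear_spline n f x) * prim k 0 x) has_integral 0)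
        {real j / real n..(real j + 1) / real n}"
      by (simp add: a_def b_def)
  qed
  then show ?thesis by simp
qed

lemma linear_spline_continuous_on:
  assumes "n \<ge> 1"
  shows "continuous_on {0..1} (linear_spline n f)"
proof -
  obtain L where "L-lipschitz_on {0..1} (linear_spline n f)"
    by (rule linear_spline_lipschitz[OF assms, of f]) (rule that)
  then show ?thesis by (rule lipschitz_on_continuous_on)
qed

lemma spline_error_eq:
  assumes k: "k \<noteq> 0" and n: "n \<ge> 1" and f: "f \<in> H1"
  shows "fourier_integral k f - spline_algorithm k n f = - (LINT x|lebesgue_on {0..1}. deriv01 f x * kernel k n x)"
proof -
  have cf: "continuous_on {0..1} f" using f by (rule H1_continuous_on)
  have cs: "continuous_on {0..1} (linear_spline n f)" using n by (rule linear_spline_continuous_on)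
  have "fourier_integral k f - spline_algorithm k n f =
      (LINT x|lebesgue_on {0..1}. f x * prim k 0 x - linear_spline n f x * prim k 0 x)"
    unfolding spline_algorithm_def fourier_integral_prim
    by (intro Bochner_Integration.integral_diff[symmetric] integrable_continuous_lebesgue_on
        continuous_intros cf cs)
  also have "\<dots> = (LINT x|lebesgue_on {0..1}. (f x - linear_spline n f x) * prim k 0 x)"
    by (simp add: left_diff_distrib)
  also have "\<dots> = - (LINT x|lebesgue_on {0..1}. deriv01 f x * kernel k n x)"
    by (intro error_representation[OF f kernel_measurable norm_kernel_le] continuous_intros cf cs
        kernel_error_has_integral k n f)
  finally show ?thesis .
qed

section \<open>Extremal functions and the values of the errors\<close>

text \<open>Conjugation and division by a real number are real-linear, so they commute with the
  derivative. An antiderivative \<open>u\<close> of the kernel thus yields the extremal function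
  that \<open>worst_case_error_eqI\<close> requires.\<close>

lemma cnj_scaled_in_H1:
  assumes lip: "L-lipschitz_on {0..1} u" and X: "finite X"
    and deriv: "\<And>x. x \<in> {0..1} - X \<Longrightarrow> (u has_vector_derivative K x) (at x within {0..1})"
    and K: "K \<in> borel_measurable (lebesgue_on {0..1})" "\<And>x. norm (K x) \<le> B"
  shows "(\<lambda>x. cnj (u x) / of_real N) \<in> H1"
    "AE x in lebesgue_on {0..1}. deriv01 (\<lambda>x. cnj (u x) / of_real N) x = cnj (K x) / of_real N"
proof -
  have lipT: "(L / \<bar>N\<bar>)-lipschitz_on {0..1} (\<lambda>x. cnj (u x) / of_real N)"
  proof (rule lipschitz_onI)
    fix x y :: real assume "x \<in> {0..1}" "y \<in> {0..1}"
    then have "norm (u x - u y) \<le> L * dist x y"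
      using lipschitz_onD[OF lip] by (simp add: dist_norm)
    moreover have "dist (cnj (u x) / of_real N) (cnj (u y) / of_real N) = norm (u x - u y) / \<bar>N\<bar>"
      by (simp add: dist_norm norm_divide flip: diff_divide_distrib complex_cnj_diff)
    ultimately show "dist (cnj (u x) / of_real N) (cnj (u y) / of_real N) \<le> L / \<bar>N\<bar> * dist x y"
      by (simp add: divide_right_mono)
  qed (use lipschitz_on_nonneg[OF lip] in simp)
  have derivT: "((\<lambda>x. cnj (u x) / of_real N) has_vector_derivative cnj (K x) / of_real N) (at x within {0..1})"
    if "x \<in> {0..1} - X" for x
    using bounded_linear.has_vector_derivative[OF bounded_linear_divide[of "of_real N"]
        bounded_linear.has_vector_derivative[OF bounded_linear_cnj deriv[OF that]]] .
  have measT: "(\<lambda>x. cnj (K x) / of_real N) \<in> borel_measurable (lebesgue_on {0..1})"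
    using K(1) by (intro borel_measurable_divide measurable_compose[OF K(1), of cnj]
        borel_measurable_continuous_onI continuous_intros) auto
  have boundT: "norm (cnj (K x) / of_real N) \<le> B / \<bar>N\<bar>" for x
    using K(2)[of x] by (simp add: norm_divide divide_right_mono)
  show "(\<lambda>x. cnj (u x) / of_real N) \<in> H1"
    "AE x in lebesgue_on {0..1}. deriv01 (\<lambda>x. cnj (u x) / of_real N) x = cnj (K x) / of_real N"
    by (rule lipschitz_in_H1[OF lipT X derivT measT boundT]; assumption)+
qed

text \<open>The slope of the interpolant of \<open>prim k 2\<close> on a piece is the mean of
  \<open>prim k 1\<close> there, that is, the term subtracted in the kernel. The nodes are excluded
  because the slope may jump at them.\<close>

lemma spline_remainder_has_vector_derivative:
  assumes k: "k \<noteq> 0" and n: "n \<ge> 1" and x: "x \<in> {0..1} - (\<lambda>j. real j / real n) ` {..n}"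
  shows "((\<lambda>x. prim k 2 x - linear_spline n (prim k 2) x) has_vector_derivative kernel k n x) (at x within {0..1})"
proof -
  from x have "x \<in> {0..1}" by simp
  with n obtain j where j: "j < n" "x \<in> {real j / real n..(real j + 1) / real n}"
    by (rule unit_interval_pieces)
  have "real j / real n \<in> (\<lambda>j. real j / real n) ` {..n}" "real (Suc j) / real n \<in> (\<lambda>j. real j / real n) ` {..n}"
    using j(1) by (intro imageI; simp)+
  then have "x \<noteq> real j / real n" "x \<noteq> (real j + 1) / real n"
    using x by (auto simp: add.commute)
  then have xin: "x \<in> {real j / real n<..<(real j + 1) / real n}" using j by auto
  let ?d = "prim k 2 ((real j + 1) / real n) - prim k 2 (real j / real n)"
  define L where "L x = prim k 2 (real j / real n) + of_real (real n * x - real j) * ?d" for x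
  have "(L has_vector_derivative piece_mean k n j) (at x)"
    unfolding L_def[abs_def] piece_mean_def has_vector_derivative_def
    by (rule derivative_eq_intros refl | simp add: scaleR_conv_of_real algebra_simps)+
  then have "(linear_spline n (prim k 2) has_vector_derivative piece_mean k n j) (at x)"
  proof (rule has_vector_derivative_transform_within_open[OF _ open_greaterThanLessThan xin])
    fix y assume "y \<in> {real j / real n<..<(real j + 1) / real n}"
    then show "L y = linear_spline n (prim k 2) y"
      unfolding L_def by (intro linear_spline_on_piece[OF n, symmetric]) auto
  qed
  moreover have "(prim k 2 has_vector_derivative prim k 1 x) (at x)"
    using prim_has_vector_derivative[OF k, of 1] by (simp add: numeral_2_eq_2)
  moreover have "kernel k n x = prim k 1 x - piece_mean k n j"
    using xin by (intro kernel_on_piece[OF n]) auto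
  ultimately show ?thesis
    by (auto intro: has_vector_derivative_at_within has_vector_derivative_diff)
qed

lemma spline_remainder_lipschitz:
  assumes k: "k \<noteq> 0" and n: "n \<ge> 1"
  obtains L where "L-lipschitz_on {0..1} (\<lambda>x. prim k 2 x - linear_spline n (prim k 2) x)"
proof -
  obtain L where "L-lipschitz_on {0..1} (linear_spline n (prim k 2))"
    by (rule linear_spline_lipschitz[OF n, of "prim k 2"]) (rule that)
  with prim_lipschitz[OF k, of 1 0 1] show thesis
    by (intro that) (rule lipschitz_on_diff, simp_all add: numeral_2_eq_2)
qed

text \<open>The norm of the kernel must be positive for the extremal function to be normalised;
  \<open>radicand_pos\<close> later establishes the assumption on \<open>s\<close>.\<close>

lemma worst_case_error_spline:
  assumes k: "k \<noteq> 0" and n: "n \<ge> 1" 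
  defines "s \<equiv> 1 - (real n)\<^sup>2 / ((real_of_int k)\<^sup>2 * pi\<^sup>2) * (sin (real_of_int k * pi / real n))\<^sup>2"
  assumes s: "s > 0"
  shows "worst_case_error (spline_algorithm k n) (fourier_integral k) H1 =
    ereal (1 / (2 * pi * real_of_int \<bar>k\<bar>) * sqrt s)"
proof -
  define N where "N = 1 / (2 * pi * real_of_int \<bar>k\<bar>) * sqrt s"
  define u where "u x = prim k 2 x - linear_spline n (prim k 2) x" for x
  have N: "N > 0" using k s by (simp add: N_def)
  have N2: "N\<^sup>2 = (1 / norm (freq k))\<^sup>2 * s"
    using s by (simp add: N_def norm_freq power_mult_distrib power_divide)
  obtain L where "L-lipschitz_on {0..1} (\<lambda>x. prim k 2 x - linear_spline n (prim k 2) x)"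
    by (rule spline_remainder_lipschitz[OF k n]) (rule that)
  then have "L-lipschitz_on {0..1} u" by (simp add: u_def[abs_def])
  note f0 = cnj_scaled_in_H1[OF this finite_imageI[OF finite_atMost]
      spline_remainder_has_vector_derivative[OF k n, folded u_def] kernel_measurable norm_kernel_le, where N = N]
  have "worst_case_error (spline_algorithm k n) (fourier_integral k) H1 = ereal N"
    by (rule worst_case_error_eqI[OF kernel_measurable norm_kernel_le _ N order_refl
          spline_error_eq[OF k n] f0])
      (use kernel_norm_has_integral[OF k n] in \<open>simp_all add: N2 s_def\<close>)
  then show ?thesis by (simp add: N_def)
qed

text \<open>The zero boundary values remove the boundary terms over the whole interval, so the
  kernel is \<open>prim k 1\<close> itself. Its modulus is constant, hence equal to its L2 norm on
  the unit interval.\<close>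

lemma worst_case_error_initial:
  assumes k: "k \<noteq> 0"
  shows "worst_case_error (\<lambda>f. 0) (fourier_integral k) H1_0 = ereal (1 / (2 * pi * real_of_int \<bar>k\<bar>))"
proof -
  define N where "N = 1 / (2 * pi * real_of_int \<bar>k\<bar>)"
  define u where "u x = prim k 2 x - prim k 2 0" for x
  have N: "N > 0" using k by (simp add: N_def)
  have norm1: "norm (prim k 1 x) = N" for x by (simp add: norm_prim norm_freq N_def)
  have meas: "prim k 1 \<in> borel_measurable (lebesgue_on {0..1})"
    by (intro continuous_imp_measurable_on_sets_lebesgue continuous_on_prim) simp
  have du: "(u has_vector_derivative prim k 1 x) (at x within {0..1})" for x
    unfolding u_def
    using has_vector_derivative_diff[OF prim_has_vector_derivative[OF k, of 1] has_vector_derivative_const]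
    by (simp add: numeral_2_eq_2)
  have "N-lipschitz_on {0..1} u"
    by (rule C1_lipschitz[OF du]) (use N norm1 in simp_all)
  note f0 = cnj_scaled_in_H1[OF this finite.emptyI du meas eq_refl[OF norm1], where N = N]
  have "u 0 = 0" "u 1 = 0" by (simp_all add: u_def prim_0 prim_1)
  then have f0': "(\<lambda>x. cnj (u x) / of_real N) \<in> H1_0"
    using f0(1) by (simp add: H1_0_def)
  have normK: "((\<lambda>x. (norm (prim k 1 x))\<^sup>2) has_integral N\<^sup>2) {0..1}"
    using has_integral_const_real[of "N\<^sup>2" 0 1] unfolding norm1 by simp
  have rep: "fourier_integral k f - 0 = - (LINT x|lebesgue_on {0..1}. deriv01 f x * prim k 1 x)"
    if "f \<in> H1_0" for f
  proof -
    have f: "f \<in> H1" "f 0 = 0" "f 1 = 0" using that by (auto simp: H1_0_def)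
    have "absolutely_continuous_on {0..1} (prim k 1)"
      using prim_lipschitz[OF k, of 0] by (intro lipschitz_imp_absolutely_continuous_on) simp
    moreover have "(prim k 1 has_vector_derivative prim k 0 x) (at x within {0..1})" for x
      using prim_has_vector_derivative[OF k, of 0] by simp
    ultimately
    have "((\<lambda>x. deriv01 f x * prim k 1 x + f x * prim k 0 x) has_integral
        (f 1 * prim k 1 1 - f 0 * prim k 1 0)) {0..1}"
      by (intro H1_integration_by_parts f(1)) auto
    then
    have "((\<lambda>x. deriv01 f x * prim k 1 x + f x * prim k 0 x) has_integral 0) {0..1}"
      by (simp add: f)
    then show ?thesis
      unfolding fourier_integral_prim diff_zero
      by (intro error_representation[OF f(1) meas, of N] continuous_intros H1_continuous_on f)
        (simp_all only: norm1 order_refl)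
  qed
  have "worst_case_error (\<lambda>f. 0) (fourier_integral k) H1_0 = ereal N"
    by (rule worst_case_error_eqI[OF meas eq_refl[OF norm1] normK N _ rep f0' f0(2)]) (auto simp: H1_0_def)
  then show ?thesis by (simp add: N_def)
qed

section \<open>Bounds and limits\<close>

text \<open>The Lagrange remainder of order four carries the even power \<open>x ^ 4\<close>, so
  bounding its cosine factor by 1 is valid for either sign of \<open>x\<close>.\<close>

lemma cos_le_Taylor4: "cos x \<le> 1 - x\<^sup>2 / 2 + x ^ 4 / 24" for x :: real
proof -
  obtain t where "cos x = (\<Sum>m<4. cos_coeff m * x ^ m) + cos (t + 1 / 2 * real 4 * pi) / fact 4 * x ^ 4"
    using Maclaurin_cos_expansion[of x 4] by blast
  moreover have "(\<Sum>m<4. cos_coeff m * x ^ m) = 1 - x\<^sup>2 / 2"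
    by (simp add: cos_coeff_def lessThan_nat_numeral fact_numeral)
  moreover have "cos (t + 1 / 2 * real 4 * pi) / fact 4 * x ^ 4 \<le> 1 / 24 * x ^ 4"
    by (intro mult_right_mono) (simp_all add: fact_numeral)
  ultimately show ?thesis by simp
qed

text \<open>The double angle formula reduces this to the Taylor bound for
  \<open>cos (2 * x)\<close>. It supplies the constant in the bound of order
  \<open>1 / n\<close>.\<close>

lemma sin_squared_lower: "x\<^sup>2 - x ^ 4 / 3 \<le> (sin x)\<^sup>2" for x :: real
proof -
  have "(sin x)\<^sup>2 = (1 - cos (2 * x)) / 2" by (simp add: cos_double_sin)
  with cos_le_Taylor4[of "2 * x"] show ?thesis by (simp add: power_mult_distrib)
qed

text \<open>Strictness comes from the half angle: \<open>(sin x)^2 = 4 * S - 4 * S^2\<close> and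
  \<open>4 * S \<le> x^2\<close>, where \<open>S^2\<close> is positive unless \<open>sin x\<close>
  vanishes.\<close>

lemma sin_squared_less:
  fixes x :: real
  assumes "x \<noteq> 0"
  shows "(sin x)\<^sup>2 < x\<^sup>2"
proof -
  define S where "S = (sin (x / 2))\<^sup>2"
  have "sin x = 2 * sin (x / 2) * cos (x / 2)" using sin_double[of "x / 2"] by simp
  then have "(sin x)\<^sup>2 = 4 * S * (cos (x / 2))\<^sup>2" by (simp add: S_def power_mult_distrib)
  then have sin_x: "(sin x)\<^sup>2 = 4 * S - 4 * S\<^sup>2"
    unfolding cos_squared_eq S_def[symmetric] by (simp add: algebra_simps power2_eq_square)
  have "S \<le> (x / 2)\<^sup>2"
    unfolding S_def using abs_sin_x_le_abs_x[of "x / 2"] by (simp only: abs_le_square_iff)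
  then have le: "4 * S \<le> x\<^sup>2" by (simp add: power_divide)
  show ?thesis
  proof (cases "S = 0")
    case True
    then show ?thesis using assms sin_x by simp
  next
    case False
    then have "S\<^sup>2 > 0" by simp
    then show ?thesis using le sin_x by linarith
  qed
qed

text \<open>By the expansion of the sine the radicand behaves like \<open>c^2 / (3 * n^2)\<close>,
  and the factor \<open>c\<close> cancels.\<close>

lemma sinc_limit:
  fixes c :: real assumes "c > 0"
  shows "(\<lambda>n::nat. 1 / (2 * c) * sqrt (1 - (real n)\<^sup>2 / c\<^sup>2 * (sin (c / real n))\<^sup>2) * real n)
     \<longlonglongrightarrow> 1 / (2 * sqrt 3)"
proof -
  \<comment> \<open>Normalises a coefficient in the goal that \<open>real_asymp\<close> leaves to
    \<open>simp\<close>.\<close>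
  have eq: "inverse (c\<^sup>2) * (c\<^sup>2 * (c * c)) = c * c"
    using assms by simp
  show ?thesis
    using assms by real_asymp (simp add: eq powr_half_sqrt real_sqrt_divide)
qed

section \<open>The closed form of the error as a real function\<close>

text \<open>Bounds and limits are proved for this real-valued form and transferred to the extended
  reals at the end.\<close>

definition spline_error :: "int \<Rightarrow> nat \<Rightarrow> real" where
  "spline_error k n = 1 / (2 * pi * real_of_int \<bar>k\<bar>) *
     sqrt (1 - (real n)\<^sup>2 / ((real_of_int k)\<^sup>2 * pi\<^sup>2) * (sin (real_of_int k * pi / real n))\<^sup>2)"

lemma radicand_pos:
  assumes "k \<noteq> 0" "n \<ge> 1"
  shows "1 - (real n)\<^sup>2 / ((real_of_int k)\<^sup>2 * pi\<^sup>2) * (sin (real_of_int k * pi / real n))\<^sup>2 > 0"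
proof -
  have "real_of_int k * pi / real n \<noteq> 0" using assms by simp
  from sin_squared_less[OF this] assms show ?thesis
    by (simp add: power_mult_distrib power_divide field_simps)
qed

lemma worst_case_error_spline_eq:
  assumes "k \<noteq> 0" "n \<ge> 1"
  shows "worst_case_error (spline_algorithm k n) (fourier_integral k) H1 = ereal (spline_error k n)"
  unfolding spline_error_def by (rule worst_case_error_spline[OF assms radicand_pos[OF assms]])

text \<open>The square root is below 1 as soon as the sine does not vanish, and a zero of the sine
  would make \<open>k\<close> a multiple of \<open>n\<close>.\<close>

lemma spline_error_less:
  assumes k: "k \<noteq> 0" and n: "n \<ge> 1" and kn: "k mod int n \<noteq> 0"
  shows "spline_error k n < 1 / (2 * pi * real_of_int \<bar>k\<bar>)"
proof -
  have "sin (real_of_int k * pi / real n) \<noteq> 0"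
  proof
    assume "sin (real_of_int k * pi / real n) = 0"
    then obtain i where "real_of_int k * pi / real n = of_int i * pi"
      by (auto simp: sin_zero_iff_int2)
    then have "real_of_int k = real_of_int (i * int n)" using n by (simp add: field_simps)
    then have "k = i * int n" by (simp only: of_int_eq_iff)
    with kn show False by simp
  qed
  then have "sqrt (1 - (real n)\<^sup>2 / ((real_of_int k)\<^sup>2 * pi\<^sup>2) * (sin (real_of_int k * pi / real n))\<^sup>2) < 1"
    using k n by simp
  with k show ?thesis
    unfolding spline_error_def by (simp add: divide_strict_right_mono)
qed

text \<open>With \<open>x = k * pi / n\<close> the square root is at most
  \<open>\<bar>x\<bar> / sqrt 3\<close>, and the factor \<open>\<bar>k\<bar> * pi\<close> cancels
  against the one in front.\<close>

lemma spline_error_le: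
  assumes k: "k \<noteq> 0" and n: "n \<ge> 1"
  shows "spline_error k n \<le> 1 / (2 * sqrt 3) * (1 / real n)"
proof -
  define x where "x = real_of_int k * pi / real n"
  have x: "x\<^sup>2 > 0" using k n by (simp add: x_def)
  have "(x\<^sup>2 - (sin x)\<^sup>2) / x\<^sup>2 \<le> x\<^sup>2 / 3"
    unfolding pos_divide_le_eq[OF x] using sin_squared_lower[of x] by (simp flip: power_add)
  then have "1 - (sin x)\<^sup>2 / x\<^sup>2 \<le> x\<^sup>2 / 3"
    using x by (simp add: diff_divide_distrib)
  then have "sqrt (1 - (sin x)\<^sup>2 / x\<^sup>2) \<le> \<bar>x\<bar> / sqrt 3"
    by (metis real_sqrt_abs real_sqrt_divide real_sqrt_le_mono)
  moreover have "spline_error k n = 1 / (2 * pi * real_of_int \<bar>k\<bar>) * sqrt (1 - (sin x)\<^sup>2 / x\<^sup>2)"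
    by (simp add: spline_error_def x_def power_mult_distrib power_divide)
  ultimately have "spline_error k n \<le> 1 / (2 * pi * real_of_int \<bar>k\<bar>) * (\<bar>x\<bar> / sqrt 3)"
    using k by (auto intro: mult_left_mono simp del: times_divide_eq_left times_divide_eq_right)
  also have "\<dots> = 1 / (2 * sqrt 3) * (1 / real n)"
    using k n by (simp add: x_def abs_mult field_simps)
  finally show ?thesis .
qed

lemma spline_error_nodes_limit:
  assumes k: "k \<noteq> 0"
  shows "(\<lambda>n. spline_error k n * real n) \<longlonglongrightarrow> 1 / (2 * sqrt 3)"
proof -
  define c where "c = real_of_int \<bar>k\<bar> * pi"
  have "c > 0" using k by (simp add: c_def)
  \<comment> \<open>The squared sine is even, so \<open>k\<close> may be replaced by its absolute
    value, which makes \<open>c\<close> positive as \<open>sinc_limit\<close> demands.\<close>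
  moreover have "spline_error k n = 1 / (2 * c) * sqrt (1 - (real n)\<^sup>2 / c\<^sup>2 * (sin (c / real n))\<^sup>2)" for n
    by (cases "k > 0") (simp_all add: spline_error_def c_def power_mult_distrib mult_ac)
  ultimately show ?thesis using sinc_limit[of c] by simp
qed

text \<open>The filter expresses that \<open>\<bar>k\<bar>\<close> tends to infinity, with both
  signs of \<open>k\<close> at once. Since the sine is bounded, the term subtracted from 1 is of
  order \<open>1 / k^2\<close>.\<close>

lemma spline_error_frequency_limit:
  assumes n: "n \<ge> 1"
  shows "((\<lambda>k. spline_error k n * real_of_int \<bar>k\<bar>) \<longlongrightarrow> 1 / (2 * pi)) (filtercomap abs at_top)"
proof -
  let ?r = "\<lambda>k::int. (real n)\<^sup>2 / ((real_of_int k)\<^sup>2 * pi\<^sup>2) * (sin (real_of_int k * pi / real n))\<^sup>2"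
  let ?F = "filtercomap abs at_top :: int filter"
  have top: "filterlim (\<lambda>k. real_of_int \<bar>k\<bar>) at_top ?F"
    by (rule filterlim_compose[OF filterlim_real_of_int_at_top filterlim_filtercomap])
  have "((\<lambda>x. (real n)\<^sup>2 / (x\<^sup>2 * pi\<^sup>2)) \<longlongrightarrow> 0) at_top" by real_asymp
  from filterlim_compose[OF this top]
  have "((\<lambda>k. (real n)\<^sup>2 / ((real_of_int k)\<^sup>2 * pi\<^sup>2)) \<longlongrightarrow> 0) ?F" by simp
  then have "(?r \<longlongrightarrow> 0) ?F"
  proof (rule tendsto_sandwich[OF _ _ tendsto_const, rotated 2])
    have "(sin y)\<^sup>2 \<le> 1" for y :: real by (simp add: abs_square_le_1)
    then show "\<forall>\<^sub>F k in ?F. ?r k \<le> (real n)\<^sup>2 / ((real_of_int k)\<^sup>2 * pi\<^sup>2)"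
      by (intro always_eventually allI mult_left_le) auto
  qed simp
  then have "((\<lambda>k. 1 / (2 * pi) * sqrt (1 - ?r k)) \<longlongrightarrow> 1 / (2 * pi) * sqrt (1 - 0)) ?F"
    by (intro tendsto_intros)
  \<comment> \<open>At \<open>k = 0\<close> division by zero makes the product with the error 0
    instead of \<open>1 / (2 * pi)\<close>, so that index has to be left out.\<close>
  moreover have "\<forall>\<^sub>F k in ?F. k \<noteq> 0"
    using eventually_filtercomapI[OF eventually_ge_at_top[of "1::int"]] by eventually_elim auto
  then have "\<forall>\<^sub>F k in ?F. 1 / (2 * pi) * sqrt (1 - ?r k) = spline_error k n * real_of_int \<bar>k\<bar>"
    by eventually_elim (simp add: spline_error_def)
  ultimately show ?thesis by (simp add: tendsto_cong)
qed

theorem theorem17: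
  shows "(\<forall>(k::int) (n::nat). k \<noteq> 0 \<longrightarrow> n \<ge> 1 \<longrightarrow>
            worst_case_error (spline_algorithm k n) (fourier_integral k) H1 =
              ereal (1 / (2 * pi * real_of_int \<bar>k\<bar>) *
                sqrt (1 - (real n)\<^sup>2 / ((real_of_int k)\<^sup>2 * pi\<^sup>2) *
                            (sin (real_of_int k * pi / real n))\<^sup>2))) \<and>
         (\<forall>(k::int) (n::nat). k \<noteq> 0 \<longrightarrow> n \<ge> 1 \<longrightarrow> k mod int n \<noteq> 0 \<longrightarrow>
            worst_case_error (spline_algorithm k n) (fourier_integral k) H1 <
              worst_case_error (\<lambda>f. 0) (fourier_integral k) H1_0) \<and>
         (\<forall>k::int. k \<noteq> 0 \<longrightarrow>
            worst_case_error (\<lambda>f. 0) (fourier_integral k) H1_0 =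
              ereal (1 / (2 * pi * real_of_int \<bar>k\<bar>))) \<and>
         (\<forall>n::nat. n \<ge> 1 \<longrightarrow>
            ((\<lambda>k::int. worst_case_error (spline_algorithm k n) (fourier_integral k) H1 *
                        ereal (real_of_int \<bar>k\<bar>)) \<longlongrightarrow> ereal (1 / (2 * pi)))
              (filtercomap abs at_top)) \<and>
         (\<forall>(k::int) (n::nat). k \<noteq> 0 \<longrightarrow> n \<ge> 1 \<longrightarrow>
            worst_case_error (spline_algorithm k n) (fourier_integral k) H1 \<le>
              ereal (1 / (2 * sqrt 3) * (1 / real n))) \<and>
         (\<forall>k::int. k \<noteq> 0 \<longrightarrow>
            (\<lambda>n::nat. worst_case_error (spline_algorithm k n) (fourier_integral k) H1 *
                        ereal (real n)) \<longlonglongrightarrow> ereal (1 / (2 * sqrt 3)))"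
proof (intro conjI allI impI)
  fix k :: int and n :: nat assume k: "k \<noteq> 0" and n: "n \<ge> 1"
  show "worst_case_error (spline_algorithm k n) (fourier_integral k) H1 =
      ereal (1 / (2 * pi * real_of_int \<bar>k\<bar>) *
        sqrt (1 - (real n)\<^sup>2 / ((real_of_int k)\<^sup>2 * pi\<^sup>2) * (sin (real_of_int k * pi / real n))\<^sup>2))"
    using worst_case_error_spline_eq[OF k n] by (simp only: spline_error_def)
  show "worst_case_error (spline_algorithm k n) (fourier_integral k) H1
      \<le> ereal (1 / (2 * sqrt 3) * (1 / real n))"
    unfolding worst_case_error_spline_eq[OF k n] ereal_less_eq by (rule spline_error_le[OF k n])
  show "worst_case_error (spline_algorithm k n) (fourier_integral k) H1 <
      worst_case_error (\<lambda>f. 0) (fourier_integral k) H1_0" if "k mod int n \<noteq> 0"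
    unfolding worst_case_error_spline_eq[OF k n] worst_case_error_initial[OF k] less_ereal.simps
    by (rule spline_error_less[OF k n that])
next
  fix k :: int assume k: "k \<noteq> 0"
  then show "worst_case_error (\<lambda>f. 0) (fourier_integral k) H1_0 =
      ereal (1 / (2 * pi * real_of_int \<bar>k\<bar>))"
    by (rule worst_case_error_initial)
  \<comment> \<open>The closed form is available for \<open>n \<ge> 1\<close>, hence eventually,
    which suffices for the limit.\<close>
  have "\<forall>\<^sub>F n in sequentially. ereal (spline_error k n * real n) =
      worst_case_error (spline_algorithm k n) (fourier_integral k) H1 * ereal (real n)"
    using eventually_ge_at_top[of 1] by eventually_elim (simp add: worst_case_error_spline_eq[OF k])
  with tendsto_ereal[OF spline_error_nodes_limit[OF k]]
  show "(\<lambda>n. worst_case_error (spline_algorithm k n) (fourier_integral k) H1 * ereal (real n))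
      \<longlonglongrightarrow> ereal (1 / (2 * sqrt 3))"
    by (rule Lim_transform_eventually)
next
  fix n :: nat assume n: "n \<ge> 1"
  have "\<forall>\<^sub>F k in filtercomap abs at_top. (k::int) \<noteq> 0"
    using eventually_filtercomapI[OF eventually_ge_at_top[of "1::int"]] by eventually_elim auto
  then have "\<forall>\<^sub>F k in filtercomap abs at_top. ereal (spline_error k n * real_of_int \<bar>k\<bar>) =
      worst_case_error (spline_algorithm k n) (fourier_integral k) H1 * ereal (real_of_int \<bar>k\<bar>)"
    by eventually_elim (simp add: worst_case_error_spline_eq[OF _ n])
  with tendsto_ereal[OF spline_error_frequency_limit[OF n]]
  show "((\<lambda>k. worst_case_error (spline_algorithm k n) (fourier_integral k) H1 * ereal (real_of_int \<bar>k\<bar>))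
      \<longlongrightarrow> ereal (1 / (2 * pi))) (filtercomap abs at_top)"
    by (rule Lim_transform_eventually)
qed

end
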